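(* For every knot grid diagram $G$ with associated oriented Legendrian knot $\vec{\mathcal K}=\vec{\mathcal K}(G)$, the homology classes $\lambda^+(\vec{\mathcal K})$ and $\lambda^-(\vec{\mathcal K})$ in $H_*(\mathit{CK}^-(G))$ are not $U$-torsion: $U^d\lambda^\pm(\vec{\mathcal K})\neq0$ for all integers $d\ge0$ (in particular they are nonzero). Consequently, for every transverse knot $\mathcal T$ the transverse invariant $\theta(\mathcal T)$ is nonzero and not $U$-torsion.
   Context: Grid diagrams. A (planar) grid diagram $G$ of grid number $n$ is an $n\times n$ array of unit squares in the plane, some marked $X$ and some $O$, with exactly one $X$ and one $O$ (in different squares) in every row and column; label them $O_1,\dots,O_n$, $X_1,\dots,X_n$. Horizontal segments from $O$ to $X$ in each row and vertical segments from $X$ to $O$ in each column, verticals over horizontals, give an oriented link diagram; $G$ is a knot grid diagram if it is a knot. On the torus $T^2$ there are horizontal and vertical grid circles. $\mathbf S(G)$ is the set of $n$-tuples of intersection points of horizontal and vertical grid circles with exactly one point on each grid circle. $\mathit{CK}^-(G)$ is the free $\mathbb Z[U_1,\dots,U_n]$-module on $\mathbf S(G)$ whose differential counts, with signs from a fixed sign assignment and weight $\prod U_i^{O_i(r)}$ ($O_i(r)$ = multiplicity of $O_i$ in $r$), the empty rectangles $r\subset T^2$ from $\mathbf x$ to $\mathbf y$ containing no $X$. Its homology is a $\mathbb Z[U]$-module, $U$ acting as any $U_i$. $\vec{\mathcal K}(G)$ is the oriented Legendrian knot whose front is obtained from the planar diagram of $G$ by smoothing northwest and southeast corners, making southwest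 and northeast corners cusps, and rotating $45^\circ$ clockwise. $\mathbf x^+(G)$ (resp. $\mathbf x^-(G)$) is the generator of upper right (resp. lower left) corners of the squares marked $X$; these are cycles, and $\lambda^+(\vec{\mathcal K})$, $\lambda^-(\vec{\mathcal K})$ denote their homology classes. For a transverse knot $\mathcal T$, $\theta(\mathcal T)=\lambda^+(\vec{\mathcal K})$ where $\vec{\mathcal K}=\vec{\mathcal K}(G)$ is a Legendrian approximation of $\mathcal T$. *)

theory Defs
  imports "HOL-Combinatorics.Permutations"
begin

text \<open>A grid diagram of grid number n is encoded by two permutations xs, os of
  {0..<n}: column i contains the X in the square (i, xs i) and the O in the
  square (i, os i).  Square (i,j) is the unit square [i,i+1] x [j,j+1]; on the
  torus all coordinates are taken mod n.  Grid circles are the lines at integer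
  coordinates 0..n-1.  The O in column i is labelled O_i (and U_i is its variable).\<close>

definition grid_diagram :: "nat \<Rightarrow> (nat \<Rightarrow> nat) \<Rightarrow> (nat \<Rightarrow> nat) \<Rightarrow> bool" where
  "grid_diagram n xs os \<longleftrightarrow>
     xs permutes {..<n} \<and> os permutes {..<n} \<and> (\<forall>i<n. xs i \<noteq> os i)"

text \<open>Following the link: from the X in column i go vertically to the O in
  column i (row os i), then horizontally in that row to the X of that row, which
  lies in column (inv xs) (os i).  The diagram is a knot iff this map is a single
  cycle through all n columns.\<close>

definition knot_grid :: "nat \<Rightarrow> (nat \<Rightarrow> nat) \<Rightarrow> (nat \<Rightarrow> nat) \<Rightarrow> bool" where
  "knot_grid n xs os \<longleftrightarrow> grid_diagram n xs os \<and> 0 < n \<and>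
     (\<forall>i<n. \<forall>j<n. \<exists>k. ((inv xs \<circ> os) ^^ k) i = j)"

text \<open>A generator (element of S(G)) is a permutation x of {0..<n}: it consists of
  the intersection points (i, x i) of vertical circle i and horizontal circle x i.\<close>

definition grid_gen :: "nat \<Rightarrow> (nat \<Rightarrow> nat) \<Rightarrow> bool" where
  "grid_gen n x \<longleftrightarrow> x permutes {..<n}"

definition in_arc :: "nat \<Rightarrow> nat \<Rightarrow> nat \<Rightarrow> nat \<Rightarrow> bool" where
  "in_arc n s w t \<longleftrightarrow> (t + n - s) mod n < w"

definition in_arc_open :: "nat \<Rightarrow> nat \<Rightarrow> nat \<Rightarrow> nat \<Rightarrow> bool" where
  "in_arc_open n s w t \<longleftrightarrow> 0 < (t + n - s) mod n \<and> (t + n - s) mod n < w"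

text \<open>A rectangle on the torus is given by a generator x and two distinct columns
  a, b: its left edge lies on vertical circle a, its right edge on vertical circle b,
  its bottom edge on horizontal circle x a and its top edge on horizontal circle x b.
  So its lower-left and upper-right corners are in x and its upper-left and
  lower-right corners are in the target generator rect_tgt x a b.  Every
  rectangle from x to y arises this way exactly once.\<close>

definition rect_valid :: "nat \<Rightarrow> (nat \<Rightarrow> nat) \<Rightarrow> nat \<Rightarrow> nat \<Rightarrow> bool" where
  "rect_valid n x a b \<longleftrightarrow> grid_gen n x \<and> a < n \<and> b < n \<and> a \<noteq> b"

definition rect_tgt :: "(nat \<Rightarrow> nat) \<Rightarrow> nat \<Rightarrow> nat \<Rightarrow> (nat \<Rightarrow> nat)" where
  "rect_tgt x a b = x(a := x b, b := x a)"

definition rect_width :: "nat \<Rightarrow> nat \<Rightarrow> nat \<Rightarrow> nat" where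
  "rect_width n a b = (b + n - a) mod n"

definition rect_height :: "nat \<Rightarrow> (nat \<Rightarrow> nat) \<Rightarrow> nat \<Rightarrow> nat \<Rightarrow> nat" where
  "rect_height n x a b = (x b + n - x a) mod n"

definition in_rect :: "nat \<Rightarrow> (nat \<Rightarrow> nat) \<Rightarrow> nat \<Rightarrow> nat \<Rightarrow> nat \<times> nat \<Rightarrow> bool" where
  "in_rect n x a b sq \<longleftrightarrow> fst sq < n \<and> snd sq < n \<and>
     in_arc n a (rect_width n a b) (fst sq) \<and> in_arc n (x a) (rect_height n x a b) (snd sq)"

definition rect_dom :: "nat \<Rightarrow> (nat \<Rightarrow> nat) \<Rightarrow> nat \<Rightarrow> nat \<Rightarrow> nat \<times> nat \<Rightarrow> int" where
  "rect_dom n x a b = (\<lambda>sq. if in_rect n x a b sq then 1 else 0)"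

definition rect_empty :: "nat \<Rightarrow> (nat \<Rightarrow> nat) \<Rightarrow> nat \<Rightarrow> nat \<Rightarrow> bool" where
  "rect_empty n x a b \<longleftrightarrow>
     \<not> (\<exists>i<n. in_arc_open n a (rect_width n a b) i \<and>
              in_arc_open n (x a) (rect_height n x a b) (x i))"

definition rect_X_free :: "nat \<Rightarrow> (nat \<Rightarrow> nat) \<Rightarrow> (nat \<Rightarrow> nat) \<Rightarrow> nat \<Rightarrow> nat \<Rightarrow> bool" where
  "rect_X_free n xs x a b \<longleftrightarrow> (\<forall>i<n. \<not> in_rect n x a b (i, xs i))"

definition rect_O :: "nat \<Rightarrow> (nat \<Rightarrow> nat) \<Rightarrow> (nat \<Rightarrow> nat) \<Rightarrow> nat \<Rightarrow> nat \<Rightarrow> nat \<Rightarrow> nat" where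
  "rect_O n os x a b = (\<lambda>i. if i < n \<and> in_rect n x a b (i, os i) then 1 else 0)"

section \<open>Sign assignments (Manolescu-Ozsvath-Szabo-Thurston)\<close>

definition sign_assignment :: "nat \<Rightarrow> ((nat \<Rightarrow> nat) \<Rightarrow> nat \<Rightarrow> nat \<Rightarrow> int) \<Rightarrow> bool" where
  "sign_assignment n S \<longleftrightarrow>
    (\<forall>x a b. rect_valid n x a b \<longrightarrow> S x a b = 1 \<or> S x a b = -1) \<and>
    \<comment> \<open>(S-1): two different decompositions of the same domain from x to z, x \<noteq> z\<close>
    (\<forall>x a1 b1 a2 b2 a3 b3 a4 b4.
       rect_valid n x a1 b1 \<longrightarrow> rect_valid n (rect_tgt x a1 b1) a2 b2 \<longrightarrow>
       rect_valid n x a3 b3 \<longrightarrow> rect_valid n (rect_tgt x a3 b3) a4 b4 \<longrightarrow>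
       rect_tgt (rect_tgt x a1 b1) a2 b2 = rect_tgt (rect_tgt x a3 b3) a4 b4 \<longrightarrow>
       rect_tgt (rect_tgt x a1 b1) a2 b2 \<noteq> x \<longrightarrow>
       (a1, b1, a2, b2) \<noteq> (a3, b3, a4, b4) \<longrightarrow>
       (\<lambda>sq. rect_dom n x a1 b1 sq + rect_dom n (rect_tgt x a1 b1) a2 b2 sq) =
       (\<lambda>sq. rect_dom n x a3 b3 sq + rect_dom n (rect_tgt x a3 b3) a4 b4 sq) \<longrightarrow>
       S x a1 b1 * S (rect_tgt x a1 b1) a2 b2 = - (S x a3 b3 * S (rect_tgt x a3 b3) a4 b4)) \<and>
    \<comment> \<open>(S-2) horizontal annulus and (S-3) vertical annulus\<close>
    (\<forall>x a b c d.
       rect_valid n x a b \<longrightarrow> rect_valid n (rect_tgt x a b) c d \<longrightarrow>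
       rect_tgt (rect_tgt x a b) c d = x \<longrightarrow>
       (let D = (\<lambda>sq. rect_dom n x a b sq + rect_dom n (rect_tgt x a b) c d sq) in
         ((\<forall>i<n. \<forall>i'<n. \<forall>j. D (i, j) = D (i', j)) \<longrightarrow>
            S x a b * S (rect_tgt x a b) c d = 1) \<and>
         ((\<forall>j<n. \<forall>j'<n. \<forall>i. D (i, j) = D (i, j')) \<longrightarrow>
            S x a b * S (rect_tgt x a b) c d = -1)))"

text \<open>An element of the free Z[U_0,...,U_(n-1)]-module on S(G) is a finitely
  supported integer-valued function on pairs (generator, monomial), a monomial
  being an exponent vector nat \<Rightarrow> nat vanishing outside {0..<n}.\<close>

definition grid_chain :: "nat \<Rightarrow> ((nat \<Rightarrow> nat) \<times> (nat \<Rightarrow> nat) \<Rightarrow> int) \<Rightarrow> bool" where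
  "grid_chain n c \<longleftrightarrow> finite {p. c p \<noteq> 0} \<and>
     (\<forall>x m. c (x, m) \<noteq> 0 \<longrightarrow> grid_gen n x \<and> (\<forall>i\<ge>n. m i = 0))"

text \<open>The differential: d(U^m' x) = sum over empty X-free rectangles r from x to y
  of S(r) U^(m' + O(r)) y, extended Z-linearly.\<close>

definition CK_minus_diff ::
  "nat \<Rightarrow> (nat \<Rightarrow> nat) \<Rightarrow> (nat \<Rightarrow> nat) \<Rightarrow> ((nat \<Rightarrow> nat) \<Rightarrow> nat \<Rightarrow> nat \<Rightarrow> int) \<Rightarrow>
   ((nat \<Rightarrow> nat) \<times> (nat \<Rightarrow> nat) \<Rightarrow> int) \<Rightarrow> ((nat \<Rightarrow> nat) \<times> (nat \<Rightarrow> nat) \<Rightarrow> int)" where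
  "CK_minus_diff n xs os S c = (\<lambda>(y, m).
     \<Sum>x\<in>{x. grid_gen n x}.
       \<Sum>(a, b)\<in>{(a, b). rect_valid n x a b \<and> rect_tgt x a b = y \<and> rect_empty n x a b \<and>
                      rect_X_free n xs x a b \<and> (\<forall>i. rect_O n os x a b i \<le> m i)}.
         S x a b * c (x, \<lambda>i. m i - rect_O n os x a b i))"

definition U_pow_gen :: "nat \<Rightarrow> nat \<Rightarrow> (nat \<Rightarrow> nat) \<Rightarrow> ((nat \<Rightarrow> nat) \<times> (nat \<Rightarrow> nat) \<Rightarrow> int)" where
  "U_pow_gen i d g = (\<lambda>p. if p = (g, \<lambda>j. if j = i then d else 0) then 1 else 0)"

definition CK_minus_boundary ::
  "nat \<Rightarrow> (nat \<Rightarrow> nat) \<Rightarrow> (nat \<Rightarrow> nat) \<Rightarrow> ((nat \<Rightarrow> nat) \<Rightarrow> nat \<Rightarrow> nat \<Rightarrow> int) \<Rightarrow>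
   ((nat \<Rightarrow> nat) \<times> (nat \<Rightarrow> nat) \<Rightarrow> int) \<Rightarrow> bool" where
  "CK_minus_boundary n xs os S z \<longleftrightarrow> (\<exists>c. grid_chain n c \<and> CK_minus_diff n xs os S c = z)"

text \<open>x^+(G): upper right corners of the X squares; the X in column i sits in square
  (i, xs i), whose upper right corner is (i+1, xs i + 1) mod n.\<close>
definition x_plus :: "nat \<Rightarrow> (nat \<Rightarrow> nat) \<Rightarrow> (nat \<Rightarrow> nat)" where
  "x_plus n xs = (\<lambda>c. if c < n then (xs ((c + n - 1) mod n) + 1) mod n else c)"

text \<open>x^-(G): lower left corners of the X squares, i.e. the points (i, xs i).\<close>
definition x_minus :: "nat \<Rightarrow> (nat \<Rightarrow> nat) \<Rightarrow> (nat \<Rightarrow> nat)" where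
  "x_minus n xs = xs"

end

theory Submission
  imports Defs
begin

text \<open>
  Setting all U_i = 1 and reducing mod 2 removes both the O's and the signs from the problem:
  it suffices to find a mod 2 cocycle on the complex of empty X-free rectangles which is odd
  on x^+ (resp. x^-).

  If all X's lie on the diagonal, then x^+ = x^- = id, and the delta function of id is a cocycle,
  since the two rectangles (a, b) and (b, a) from a transposition to id are both empty and X-free.

  Any diagram is reached from this one by exchanging adjacent columns i - 1 and i. Weighting a
  rectangle by how often its vertical sides on circle i cross row h gives a weight which depends
  only on the domain, additively, so counting with this weight commutes with the differential
  mod 2. If h is the row of one of the two X's being exchanged, the terms of lowest order in the
  number of X's form a chain map between the complexes of the two diagrams. It is the pentagon map
  for the commutation move, and for a suitable choice of h it sends x^+ to x^+ (resp. x^- to x^-),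
  so cocycles can be pulled back along it.
\<close>

section \<open>Cyclic order and pairs of rectangles\<close>

definition cyc :: "nat \<Rightarrow> nat \<Rightarrow> nat \<Rightarrow> bool" where
  "cyc a b c \<longleftrightarrow> a < b \<and> b < c \<or> b < c \<and> c < a \<or> c < a \<and> a < b"

text \<open>Indicator of the cyclic half-open arc from a to b; it is 0 if a = b.\<close>

definition arc_ind :: "nat \<Rightarrow> nat \<Rightarrow> nat \<Rightarrow> int" where
  "arc_ind a b t = of_bool (a < b \<and> a \<le> t \<and> t < b \<or> b < a \<and> (a \<le> t \<or> t < b))"

lemma arc_ind_nonneg [simp]: "0 \<le> arc_ind a b t"
  by (simp add: arc_ind_def)

lemma arc_ind_eq_of_bool: "t \<noteq> a \<Longrightarrow> t \<noteq> b \<Longrightarrow> arc_ind a b t = of_bool (cyc a t b)"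
  by (auto simp: arc_ind_def cyc_def)

lemma arc_ind_split: "cyc a b c \<Longrightarrow> arc_ind a c t = arc_ind a b t + arc_ind b c t"
  by (auto simp: arc_ind_def cyc_def)

lemma arc_ind_complement: "a \<noteq> b \<Longrightarrow> arc_ind a b t + arc_ind b a t = 1"
  by (auto simp: arc_ind_def)

lemma arc_ind_left [simp]: "a \<noteq> b \<Longrightarrow> arc_ind a b a = 1"
  by (auto simp: arc_ind_def)

lemma cyc_rotate: "cyc a b c \<longleftrightarrow> cyc b c a"
  by (auto simp: cyc_def)

lemma cyc_swap: "a \<noteq> b \<Longrightarrow> b \<noteq> c \<Longrightarrow> a \<noteq> c \<Longrightarrow> cyc a c b \<longleftrightarrow> \<not> cyc a b c"
  by (auto simp: cyc_def)

text \<open>An arc that starts inside another arc and ends outside leaves it through its end; an arc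
  that starts outside and ends inside enters through its start.\<close>

lemma cyc_exit:
  assumes "cyc c a d" "\<not> cyc c b d" "b \<noteq> c" "b \<noteq> d"
  shows "cyc a d b" "cyc b c a"
  using assms by (auto simp: cyc_def)

text \<open>The multiplicity of the square (i, j) in the rectangle; as a product of arc indicators
  it turns identities between domains into ring identities.\<close>

definition mult :: "(nat \<Rightarrow> nat) \<Rightarrow> nat \<Rightarrow> nat \<Rightarrow> nat \<Rightarrow> nat \<Rightarrow> int" where
  "mult x a b i j = arc_ind a b i * arc_ind (x a) (x b) j"

lemma mult_nonneg [simp]: "0 \<le> mult x a b i j"
  by (simp add: mult_def)

text \<open>A point (i, x i) is tested through the square above and to the right of it. For
  injective \<open>x\<close> and i outside {a, b} the point lies on none of the four circles
  carrying the sides, so the half-open arcs test membership in the open rectangle.\<close>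

definition empty_rects :: "nat \<Rightarrow> (nat \<Rightarrow> nat) \<Rightarrow> (nat \<times> nat) set" where
  "empty_rects n x = {(a, b). a < n \<and> b < n \<and> a \<noteq> b \<and>
     (\<forall>i<n. i \<noteq> a \<longrightarrow> i \<noteq> b \<longrightarrow> mult x a b i (x i) = 0)}"

lemma finite_empty_rects [simp]: "finite (empty_rects n x)"
  by (rule finite_subset[of _ "{..<n} \<times> {..<n}"]) (auto simp: empty_rects_def)

lemma rect_tgt_compose: "rect_tgt x a b = x \<circ> transpose a b"
  by (auto simp: rect_tgt_def transpose_def fun_eq_iff)

lemma rect_tgt_permutes:
  "x permutes {..<n} \<Longrightarrow> a < n \<Longrightarrow> b < n \<Longrightarrow> rect_tgt x a b permutes {..<n}"
  unfolding rect_tgt_compose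
  by (intro permutes_compose permutes_swap_id) auto

text \<open>Two successive rectangles sharing one column involve three columns; this isolates the
  condition at the third one as a statement about cyclic orders.\<close>

lemma empty_rects_third:
  assumes "inj x" "a < n" "b < n" "c < n" "a \<noteq> b" "c \<noteq> a" "c \<noteq> b"
  shows "(a, b) \<in> empty_rects n x \<longleftrightarrow> \<not> (cyc a c b \<and> cyc (x a) (x c) (x b)) \<and>
    (\<forall>i<n. i \<notin> {a, b, c} \<longrightarrow> mult x a b i (x i) = 0)"
proof -
  have "mult x a b c (x c) = 0 \<longleftrightarrow> \<not> (cyc a c b \<and> cyc (x a) (x c) (x b))"
    using assms by (auto simp: mult_def arc_ind_eq_of_bool inj_eq)
  then show ?thesis using assms by (auto simp: empty_rects_def)
qed

section \<open>Two successive empty rectangles and their total domain\<close>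

type_synonym two_rects = "(nat \<times> nat) \<times> (nat \<times> nat)"

fun dom2 :: "(nat \<Rightarrow> nat) \<Rightarrow> two_rects \<Rightarrow> nat \<Rightarrow> nat \<Rightarrow> int" where
  "dom2 x ((a, b), (c, d)) i j = mult x a b i j + mult (rect_tgt x a b) c d i j"

fun tgt2 :: "(nat \<Rightarrow> nat) \<Rightarrow> two_rects \<Rightarrow> nat \<Rightarrow> nat" where
  "tgt2 x ((a, b), (c, d)) = rect_tgt (rect_tgt x a b) c d"

definition rect_pairs :: "nat \<Rightarrow> (nat \<Rightarrow> nat) \<Rightarrow> two_rects set" where
  "rect_pairs n x = Sigma (empty_rects n x) (\<lambda>(a, b). empty_rects n (rect_tgt x a b))"

lemma finite_pairs [simp]: "finite (rect_pairs n x)"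
  unfolding rect_pairs_def by (rule finite_SigmaI) auto

lemma rect_pairs_iff:
  "((a, b), (c, d)) \<in> rect_pairs n x \<longleftrightarrow> (a, b) \<in> empty_rects n x \<and> (c, d) \<in> empty_rects n (rect_tgt x a b)"
  by (simp add: rect_pairs_def)

text \<open>If \<open>A\<close> contains the columns of both rectangles, the generator is unchanged
  outside \<open>A\<close>. Multiplicities are nonnegative, so one condition on the total domain
  covers the emptiness of both rectangles there.\<close>

abbreviation avoids :: "nat \<Rightarrow> (nat \<Rightarrow> nat) \<Rightarrow> nat set \<Rightarrow> two_rects \<Rightarrow> bool" where
  "avoids n x A P \<equiv> \<forall>i<n. i \<notin> A \<longrightarrow> dom2 x P i (x i) = 0"

lemma add_mult_eq_0: "mult x a b i j + mult y c d i' j' = 0 \<longleftrightarrow> mult x a b i j = 0 \<and> mult y c d i' j' = 0"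
  by (simp add: add_nonneg_eq_0_iff)

lemma inj_rect_tgt: "inj x \<Longrightarrow> inj (rect_tgt x a b)"
  unfolding rect_tgt_compose by (simp add: inj_compose)

text \<open>Let A and B be the cyclic orders of the three columns and of their rows. The emptiness
  conditions at the third column are two disjunctions that resolve to a single literal: for example
  A \<or> B and A \<or> \<not> B leave A.\<close>

lemma rect_pairs_shared:
  assumes inj: "inj x" and lt: "p < n" "q < n" "r < n" and neq: "p \<noteq> q" "q \<noteq> r" "p \<noteq> r"
  shows
    "((p, q), (q, r)) \<in> rect_pairs n x \<longleftrightarrow> cyc p q r \<and> avoids n x {p, q, r} ((p, q), (q, r))"
    "((p, q), (r, q)) \<in> rect_pairs n x \<longleftrightarrow> cyc (x p) (x q) (x r) \<and> avoids n x {p, q, r} ((p, q), (r, q))"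
    "((p, q), (p, r)) \<in> rect_pairs n x \<longleftrightarrow> cyc (x p) (x q) (x r) \<and> avoids n x {p, q, r} ((p, q), (p, r))"
    "((p, q), (r, p)) \<in> rect_pairs n x \<longleftrightarrow> cyc p q r \<and> avoids n x {p, q, r} ((p, q), (r, p))"
proof -
  let ?y = "rect_tgt x p q"
  have y: "?y p = x q" "?y q = x p" "?y r = x r" "\<And>i. i \<notin> {p, q, r} \<Longrightarrow> ?y i = x i"
    using neq by (auto simp: rect_tgt_def)
  have xneq: "x p \<noteq> x q" "x q \<noteq> x r" "x p \<noteq> x r"
    using neq inj by (auto simp: inj_eq)
  have ex: "(p, q) \<in> empty_rects n x \<longleftrightarrow> \<not> (cyc p r q \<and> cyc (x p) (x r) (x q)) \<and>
    (\<forall>i<n. i \<notin> {p, q, r} \<longrightarrow> mult x p q i (x i) = 0)"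
    by (rule empty_rects_third) (use assms in auto)
  have 1: "(q, r) \<in> empty_rects n ?y \<longleftrightarrow> \<not> (cyc q p r \<and> cyc (x p) (x q) (x r)) \<and>
    (\<forall>i<n. i \<notin> {p, q, r} \<longrightarrow> mult ?y q r i (x i) = 0)"
    using empty_rects_third[of ?y q n r p] assms y inj_rect_tgt[OF inj] by auto
  have 2: "(r, q) \<in> empty_rects n ?y \<longleftrightarrow> \<not> (cyc r p q \<and> cyc (x r) (x q) (x p)) \<and>
    (\<forall>i<n. i \<notin> {p, q, r} \<longrightarrow> mult ?y r q i (x i) = 0)"
    using empty_rects_third[of ?y r n q p] assms y inj_rect_tgt[OF inj] by auto
  have 3: "(p, r) \<in> empty_rects n ?y \<longleftrightarrow> \<not> (cyc p q r \<and> cyc (x q) (x p) (x r)) \<and>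
    (\<forall>i<n. i \<notin> {p, q, r} \<longrightarrow> mult ?y p r i (x i) = 0)"
    using empty_rects_third[of ?y p n r q] assms y inj_rect_tgt[OF inj] by auto
  have 4: "(r, p) \<in> empty_rects n ?y \<longleftrightarrow> \<not> (cyc r q p \<and> cyc (x r) (x p) (x q)) \<and>
    (\<forall>i<n. i \<notin> {p, q, r} \<longrightarrow> mult ?y r p i (x i) = 0)"
    using empty_rects_third[of ?y r n p q] assms y inj_rect_tgt[OF inj] by auto
  have c: "cyc p r q \<longleftrightarrow> \<not> cyc p q r" "cyc q p r \<longleftrightarrow> \<not> cyc p q r" "cyc r q p \<longleftrightarrow> \<not> cyc p q r"
     "cyc r p q \<longleftrightarrow> cyc p q r"
    using cyc_swap[of p q r] neq cyc_rotate by metis+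
  have cx: "cyc (x p) (x r) (x q) \<longleftrightarrow> \<not> cyc (x p) (x q) (x r)" "cyc (x q) (x p) (x r) \<longleftrightarrow> \<not> cyc (x p) (x q) (x r)"
     "cyc (x r) (x q) (x p) \<longleftrightarrow> \<not> cyc (x p) (x q) (x r)" "cyc (x r) (x p) (x q) \<longleftrightarrow> cyc (x p) (x q) (x r)"
    using cyc_swap[of "x p" "x q" "x r"] xneq cyc_rotate by metis+
  show "((p, q), (q, r)) \<in> rect_pairs n x \<longleftrightarrow> cyc p q r \<and> avoids n x {p, q, r} ((p, q), (q, r))"
    unfolding rect_pairs_iff ex 1 c cx dom2.simps add_mult_eq_0 by blast
  show "((p, q), (r, q)) \<in> rect_pairs n x \<longleftrightarrow> cyc (x p) (x q) (x r) \<and> avoids n x {p, q, r} ((p, q), (r, q))"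
    unfolding rect_pairs_iff ex 2 c cx dom2.simps add_mult_eq_0 by blast
  show "((p, q), (p, r)) \<in> rect_pairs n x \<longleftrightarrow> cyc (x p) (x q) (x r) \<and> avoids n x {p, q, r} ((p, q), (p, r))"
    unfolding rect_pairs_iff ex 3 c cx dom2.simps add_mult_eq_0 by blast
  show "((p, q), (r, p)) \<in> rect_pairs n x \<longleftrightarrow> cyc p q r \<and> avoids n x {p, q, r} ((p, q), (r, p))"
    unfolding rect_pairs_iff ex 4 c cx dom2.simps add_mult_eq_0 by blast
qed

text \<open>Splitting the long column arc and the long row arc writes both sides as the same three
  blocks of an L-shape. The left sides are the vertical cuts at the reentrant corner, the right
  sides the horizontal cuts.\<close>

lemma dom2_shared:
  assumes neq: "p \<noteq> q" "q \<noteq> r" "p \<noteq> r" and c: "cyc p q r"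
  shows "cyc (x p) (x q) (x r) \<Longrightarrow> dom2 x ((p, q), (q, r)) = dom2 x ((q, r), (p, r))"
    "cyc (x p) (x r) (x q) \<Longrightarrow> dom2 x ((p, q), (q, r)) = dom2 x ((p, r), (p, q))"
    "cyc (x p) (x q) (x r) \<Longrightarrow> dom2 x ((q, r), (p, q)) = dom2 x ((p, q), (p, r))"
    "cyc (x p) (x r) (x q) \<Longrightarrow> dom2 x ((q, r), (p, q)) = dom2 x ((p, r), (q, r))"
proof -
  note d = mult_def rect_tgt_def arc_ind_split[OF c] algebra_simps
  show "dom2 x ((p, q), (q, r)) = dom2 x ((q, r), (p, r))" if "cyc (x p) (x q) (x r)"
    using neq arc_ind_split[OF that] by (intro ext) (simp add: d)
  show "dom2 x ((p, q), (q, r)) = dom2 x ((p, r), (p, q))" if "cyc (x p) (x r) (x q)"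
    using neq arc_ind_split[OF that] by (intro ext) (simp add: d)
  show "dom2 x ((q, r), (p, q)) = dom2 x ((p, q), (p, r))" if "cyc (x p) (x q) (x r)"
    using neq arc_ind_split[OF that] by (intro ext) (simp add: d)
  show "dom2 x ((q, r), (p, q)) = dom2 x ((p, r), (q, r))" if "cyc (x p) (x r) (x q)"
  proof -
    have "cyc (x q) (x p) (x r)" using that cyc_rotate by blast
    then show ?thesis using neq arc_ind_split by (intro ext) (simp add: d)
  qed
qed

lemma tgt2_shared:
  assumes neq: "p \<noteq> q" "q \<noteq> r" "p \<noteq> r"
  shows "tgt2 x ((p, q), (q, r)) = tgt2 x ((q, r), (p, r))"
    "tgt2 x ((p, q), (q, r)) = tgt2 x ((p, r), (p, q))"
    "tgt2 x ((q, r), (p, q)) = tgt2 x ((p, q), (p, r))"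
    "tgt2 x ((q, r), (p, q)) = tgt2 x ((p, r), (q, r))"
  using neq by (auto simp: rect_tgt_def fun_eq_iff)

text \<open>Rectangles without a common column can be taken in either order. Only the corners of one
  relative to the interior of the other need an argument.\<close>

lemma rect_pairs_disjoint:
  assumes inj: "inj x" and P: "((a, b), (c, d)) \<in> rect_pairs n x" and disj: "{a, b} \<inter> {c, d} = {}"
  shows "((c, d), (a, b)) \<in> rect_pairs n x"
proof -
  have lt: "a < n" "b < n" "c < n" "d < n" and neq: "a \<noteq> b" "c \<noteq> d"
    using P by (auto simp: rect_pairs_iff empty_rects_def)
  have neqs: "c \<noteq> a" "c \<noteq> b" "d \<noteq> a" "d \<noteq> b" using disj by auto
  have m: "mult (rect_tgt x a b) c d = mult x c d" "mult (rect_tgt x c d) a b = mult x a b"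
    using neqs by (auto simp: mult_def rect_tgt_def fun_eq_iff)
  have xneq: "x a \<noteq> x b" "x c \<noteq> x d" "x c \<noteq> x a" "x c \<noteq> x b" "x d \<noteq> x a" "x d \<noteq> x b"
    using neq neqs inj by (auto simp: inj_eq)
  have ab: "\<And>i. i < n \<Longrightarrow> i \<noteq> a \<Longrightarrow> i \<noteq> b \<Longrightarrow> mult x a b i (x i) = 0"
    using P by (auto simp: rect_pairs_iff empty_rects_def)
  have cd: "\<And>i. i < n \<Longrightarrow> i \<noteq> c \<Longrightarrow> i \<noteq> d \<Longrightarrow> mult x c d i (rect_tgt x a b i) = 0"
    using P by (auto simp: rect_pairs_iff empty_rects_def m)
  have ne: "\<not> (cyc a c b \<and> cyc (x a) (x c) (x b))" "\<not> (cyc a d b \<and> cyc (x a) (x d) (x b))"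
    "\<not> (cyc c a d \<and> cyc (x c) (x b) (x d))" "\<not> (cyc c b d \<and> cyc (x c) (x a) (x d))"
    using ab[of c] ab[of d] cd[of a] cd[of b] lt neq neqs xneq
    by (auto simp: mult_def arc_ind_eq_of_bool rect_tgt_def)
  \<comment> \<open>If (a, x a) were inside the second rectangle, the last two facts of
    \<open>ne\<close> would put b and x b outside its arcs. By \<open>cyc_exit\<close> the arcs of
    the first rectangle then pass d and x d, against the second fact of \<open>ne\<close>. The other
    three cases are alike.\<close>
  have "\<not> (cyc c a d \<and> cyc (x c) (x a) (x d))" "\<not> (cyc c b d \<and> cyc (x c) (x b) (x d))"
    "\<not> (cyc a c b \<and> cyc (x a) (x d) (x b))" "\<not> (cyc a d b \<and> cyc (x a) (x c) (x b))"
    using ne neqs xneq neq by (metis cyc_exit cyc_rotate)+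
  then have "mult x c d a (x a) = 0" "mult x c d b (x b) = 0"
    "mult x a b c (x d) = 0" "mult x a b d (x c) = 0"
    using neq neqs xneq by (auto simp: mult_def arc_ind_eq_of_bool)
  then have "mult x c d i (x i) = 0" if "i < n" "i \<noteq> c" "i \<noteq> d" for i
    using that cd[of i] by (cases "i = a"; cases "i = b") (auto simp: rect_tgt_def)
  moreover have "mult x a b i (rect_tgt x c d i) = 0" if "i < n" "i \<noteq> a" "i \<noteq> b" for i
    using that ab[of i] \<open>mult x a b c (x d) = 0\<close> \<open>mult x a b d (x c) = 0\<close>
    by (cases "i = c"; cases "i = d") (auto simp: rect_tgt_def)
  ultimately show ?thesis using lt neq by (auto simp: rect_pairs_iff empty_rects_def m)
qed

text \<open>The other decomposition of an L-shaped (or disconnected) domain into two rectangles. Its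
  value is irrelevant if both rectangles have the same two columns.\<close>

fun recut :: "(nat \<Rightarrow> nat) \<Rightarrow> two_rects \<Rightarrow> two_rects" where
  "recut x ((a, b), (c, d)) =
     (if c = b then if cyc (x a) (x b) (x d) then ((b, d), (a, d)) else ((a, d), (a, b))
      else if d = b then if cyc a b c then ((c, a), (a, b)) else ((c, b), (a, c))
      else if c = a then if cyc a b d then ((b, d), (a, b)) else ((a, d), (d, b))
      else if d = a then if cyc (x c) (x a) (x b) then ((c, a), (c, b)) else ((c, b), (a, b))
      else ((c, d), (a, b)))"

abbreviation recut_ok :: "nat \<Rightarrow> (nat \<Rightarrow> nat) \<Rightarrow> two_rects \<Rightarrow> bool" where
  "recut_ok n x P \<equiv> recut x P \<in> rect_pairs n x \<and> tgt2 x (recut x P) = tgt2 x P \<and>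
     dom2 x (recut x P) = dom2 x P \<and> recut x (recut x P) = P \<and> recut x P \<noteq> P"

text \<open>Since \<open>recut\<close> undoes itself on \<open>P\<close>, each couple of
  decompositions has to be treated from one side only.\<close>

lemma recut_ok_sym:
  assumes "recut_ok n x P" "P \<in> rect_pairs n x" "recut x P = Q"
  shows "recut_ok n x Q"
  using assms by metis

text \<open>The two vertical cuts are treated directly, each with a partner chosen by the cyclic
  order \<open>?h\<close> of the rows. The four horizontal cuts force \<open>?h\<close> or its
  negation and follow by symmetry.\<close>

lemma recut_shared:
  assumes inj: "inj x" and lt: "p < n" "q < n" "r < n" and neq: "p \<noteq> q" "q \<noteq> r" "p \<noteq> r"
    and c: "cyc p q r"
  shows "((p, q), (q, r)) \<in> rect_pairs n x \<Longrightarrow> recut_ok n x ((p, q), (q, r))"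
    "((q, r), (p, q)) \<in> rect_pairs n x \<Longrightarrow> recut_ok n x ((q, r), (p, q))"
    "((q, r), (p, r)) \<in> rect_pairs n x \<Longrightarrow> recut_ok n x ((q, r), (p, r))"
    "((p, q), (p, r)) \<in> rect_pairs n x \<Longrightarrow> recut_ok n x ((p, q), (p, r))"
    "((p, r), (p, q)) \<in> rect_pairs n x \<Longrightarrow> recut_ok n x ((p, r), (p, q))"
    "((p, r), (q, r)) \<in> rect_pairs n x \<Longrightarrow> recut_ok n x ((p, r), (q, r))"
proof -
  have xneq: "x p \<noteq> x q" "x q \<noteq> x r" "x p \<noteq> x r"
    using neq inj by (auto simp: inj_eq)
  let ?h = "cyc (x p) (x q) (x r)"
  note cs = c iffD1[OF cyc_rotate c] iffD2[OF cyc_rotate c]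
  have cn: "\<not> cyc p r q" "\<not> cyc r q p" "\<not> cyc q p r"
    using cyc_swap[of p q r] neq c cyc_rotate by metis+
  have h: "cyc (x p) (x r) (x q) \<longleftrightarrow> \<not> ?h" "cyc (x q) (x p) (x r) \<longleftrightarrow> \<not> ?h"
     "cyc (x r) (x q) (x p) \<longleftrightarrow> \<not> ?h" "cyc (x r) (x p) (x q) \<longleftrightarrow> ?h" "cyc (x q) (x r) (x p) \<longleftrightarrow> ?h"
    using cyc_swap[of "x p" "x q" "x r"] xneq cyc_rotate by metis+
  note neq' = neq neq[symmetric]
  note ps = rect_pairs_shared[OF inj]
  note P1 = ps(1)[of p n q r] and P2 = ps(4)[of q n r p] and P3 = ps(2)[of q n r p]
    and P4 = ps(3)[of p n q r] and P5 = ps(3)[of p n r q] and P6 = ps(2)[of p n r q]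
  note P = P1[OF lt neq] P2[OF lt(2,3,1) neq'(2,6,4)] P3[OF lt(2,3,1) neq'(2,6,4)]
    P4[OF lt neq] P5[OF lt(1,3,2) neq'(3,5,1)] P6[OF lt(1,3,2) neq'(3,5,1)]
  have sets: "{q, r, p} = {p, q, r}" "{p, r, q} = {p, q, r}" by auto
  note P = P[unfolded sets]
  note D = dom2_shared[OF neq c, of x, unfolded h]
  note T = tgt2_shared[OF neq, of x]
  have R: "recut x ((p, q), (q, r)) = (if ?h then ((q, r), (p, r)) else ((p, r), (p, q)))"
    "recut x ((q, r), (p, q)) = (if ?h then ((p, q), (p, r)) else ((p, r), (q, r)))"
    "?h \<Longrightarrow> recut x ((q, r), (p, r)) = ((p, q), (q, r))"
    "?h \<Longrightarrow> recut x ((p, q), (p, r)) = ((q, r), (p, q))"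
    "\<not> ?h \<Longrightarrow> recut x ((p, r), (p, q)) = ((p, q), (q, r))"
    "\<not> ?h \<Longrightarrow> recut x ((p, r), (q, r)) = ((q, r), (p, q))"
    using neq' cs cn h by simp_all
  \<comment> \<open>Both memberships reduce to \<open>avoids\<close> for one and the same domain,
    since the cyclic orders are known.\<close>
  have E: "?h \<Longrightarrow> ((q, r), (p, r)) \<in> rect_pairs n x \<longleftrightarrow> ((p, q), (q, r)) \<in> rect_pairs n x"
    "?h \<Longrightarrow> ((p, q), (p, r)) \<in> rect_pairs n x \<longleftrightarrow> ((q, r), (p, q)) \<in> rect_pairs n x"
    "\<not> ?h \<Longrightarrow> ((p, r), (p, q)) \<in> rect_pairs n x \<longleftrightarrow> ((p, q), (q, r)) \<in> rect_pairs n x"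
    "\<not> ?h \<Longrightarrow> ((p, r), (q, r)) \<in> rect_pairs n x \<longleftrightarrow> ((q, r), (p, q)) \<in> rect_pairs n x"
    unfolding P using D by (simp_all add: cs h del: dom2.simps)
  show 1: "recut_ok n x ((p, q), (q, r))" if "((p, q), (q, r)) \<in> rect_pairs n x"
    using that E(1,3) D(1,2) T(1,2) R(1,3,5) neq' by (cases ?h) (simp_all del: dom2.simps tgt2.simps recut.simps)
  show 2: "recut_ok n x ((q, r), (p, q))" if "((q, r), (p, q)) \<in> rect_pairs n x"
    using that E(2,4) D(3,4) T(3,4) R(2,4,6) neq' by (cases ?h) (simp_all del: dom2.simps tgt2.simps recut.simps)
  show "recut_ok n x ((q, r), (p, r))" if "((q, r), (p, r)) \<in> rect_pairs n x"
  proof -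
    have "?h" using that P(3) h by blast
    then show ?thesis using E(1) R(1) that by (intro recut_ok_sym[OF 1]) simp_all
  qed
  show "recut_ok n x ((p, q), (p, r))" if "((p, q), (p, r)) \<in> rect_pairs n x"
  proof -
    have "?h" using that P(4) h by blast
    then show ?thesis using E(2) R(2) that by (intro recut_ok_sym[OF 2]) simp_all
  qed
  show "recut_ok n x ((p, r), (p, q))" if "((p, r), (p, q)) \<in> rect_pairs n x"
  proof -
    have "\<not> ?h" using that P(5) h by blast
    then show ?thesis using E(3) R(1) that by (intro recut_ok_sym[OF 1]) simp_all
  qed
  show "recut_ok n x ((p, r), (q, r))" if "((p, r), (q, r)) \<in> rect_pairs n x"
  proof -
    have "\<not> ?h" using that P(6) h by blast
    then show ?thesis using E(4) R(2) that by (intro recut_ok_sym[OF 2]) simp_all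
  qed
qed

text \<open>A return to \<open>x\<close> is excluded, so the two rectangles share exactly one column
  or none. Where the shared column ends one rectangle and starts the other, emptiness fixes the
  cyclic order; otherwise either order can occur.\<close>

lemma recut:
  assumes inj: "inj x" and P: "P \<in> rect_pairs n x" and z: "tgt2 x P \<noteq> x"
  shows "recut_ok n x P"
proof -
  obtain a b c d where Peq: "P = ((a, b), (c, d))" by (metis prod.exhaust)
  have lt: "a < n" "b < n" "c < n" "d < n" and neq: "a \<noteq> b" "c \<noteq> d"
    using P by (auto simp: Peq rect_pairs_iff empty_rects_def)
  have nn: "\<not> (c = a \<and> d = b)" "\<not> (c = b \<and> d = a)"
    using z by (auto simp: Peq rect_tgt_def)
  note S = recut_shared[OF inj]
  note cycs = cyc_swap cyc_rotate
  consider "c = b" "d \<noteq> a" | "d = b" "c \<noteq> a" | "c = a" "d \<noteq> b" | "d = a" "c \<noteq> b"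
    | "{a, b} \<inter> {c, d} = {}"
    using nn by blast
  then show ?thesis
  proof cases
    case 1
    then have "cyc a b d" using P rect_pairs_shared(1)[OF inj, of a n b d] lt neq by (simp add: Peq del: dom2.simps)
    then show ?thesis using P S(1)[of a n b d] lt neq 1 unfolding Peq by blast
  next
    case 2
    then have "cyc c a b \<or> cyc a c b" using neq cycs by metis
    then show ?thesis using P S(3)[of c n a b] S(6)[of a n c b] lt neq 2 unfolding Peq by blast
  next
    case 3
    then have "cyc a b d \<or> cyc a d b" using neq cycs by metis
    then show ?thesis using P S(4)[of a n b d] S(5)[of a n d b] lt neq 3 unfolding Peq by blast
  next
    case 4
    then have "cyc a b c" using P rect_pairs_shared(4)[OF inj, of a n b c] lt neq by (simp add: Peq del: dom2.simps)
    then have "cyc c a b" using cyc_rotate by blast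
    then show ?thesis using P S(2)[of c n a b] lt neq 4 unfolding Peq by blast
  next
    case 5
    then have n: "c \<noteq> a" "c \<noteq> b" "d \<noteq> a" "d \<noteq> b" by auto
    then have "recut x P = ((c, d), (a, b))" "recut x ((c, d), (a, b)) = P" by (auto simp: Peq)
    moreover have "((c, d), (a, b)) \<in> rect_pairs n x" using rect_pairs_disjoint[OF inj] P 5 unfolding Peq by blast
    moreover have "tgt2 x ((c, d), (a, b)) = tgt2 x P" using n by (auto simp: Peq rect_tgt_def fun_eq_iff)
    moreover have "dom2 x ((c, d), (a, b)) = dom2 x P"
      using n by (auto simp: Peq rect_tgt_def mult_def fun_eq_iff)
    ultimately show ?thesis using n by (auto simp: Peq)
  qed
qed

section \<open>Counting pairs of rectangles by their domain\<close>

lemma even_sum_involution: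
  fixes f :: "'a \<Rightarrow> int"
  assumes "finite T" and "\<And>t. t \<in> T \<Longrightarrow> \<tau> t \<in> T \<and> \<tau> (\<tau> t) = t \<and> \<tau> t \<noteq> t \<and> f (\<tau> t) = f t"
  shows "even (sum f T)"
  using assms
proof (induction "card T" arbitrary: T rule: less_induct)
  case less
  show ?case
  proof (cases "T = {}")
    case False
    then obtain t where t: "t \<in> T" by blast
    note tt = less.prems(2)[OF t]
    let ?T = "T - {t, \<tau> t}"
    have fin: "finite T" by fact
    have "even (sum f ?T)"
    proof (rule less.hyps)
      show "card ?T < card T" using t fin by (intro psubset_card_mono) auto
      show "\<tau> s \<in> ?T \<and> \<tau> (\<tau> s) = s \<and> \<tau> s \<noteq> s \<and> f (\<tau> s) = f s" if "s \<in> ?T" for s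
        using that less.prems(2)[of s] tt by auto
    qed (use fin in simp)
    moreover have "sum f T = sum f ?T + sum f {t, \<tau> t}"
      using t tt fin by (intro sum.subset_diff) auto
    moreover have "sum f {t, \<tau> t} = f t + f t" using tt by (metis sum.insert sum.empty finite.intros singletonD add_0_right insert_absorb empty_iff)
    ultimately show ?thesis by simp
  qed simp
qed

text \<open>Modulo 2 the sum equals the jump of the multiplicity across circle i in row h, hence the
  crossing number of the boundary of the domain with that row.\<close>

definition crossing :: "nat \<Rightarrow> nat \<Rightarrow> (nat \<Rightarrow> nat \<Rightarrow> int) \<Rightarrow> int" where
  "crossing i h D = D i h + D (i - 1) h"

definition marks :: "nat \<Rightarrow> (nat \<Rightarrow> nat) \<Rightarrow> (nat \<Rightarrow> nat \<Rightarrow> int) \<Rightarrow> int" where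
  "marks n p D = (\<Sum>c<n. D c (p c))"

lemma crossing_dom2: "crossing i h (dom2 x ((a, b), (c, d))) =
    crossing i h (mult x a b) + crossing i h (mult (rect_tgt x a b) c d)"
  by (simp add: crossing_def)

lemma marks_dom2: "marks n p (dom2 x ((a, b), (c, d))) =
    marks n p (mult x a b) + marks n p (mult (rect_tgt x a b) c d)"
  by (simp add: marks_def sum.distrib)

lemma marks_nonneg: "0 \<le> marks n p (mult x a b)"
  by (simp add: marks_def sum_nonneg)

lemma marks_ge: "c < n \<Longrightarrow> mult x a b c (p c) \<le> marks n p (mult x a b)"
  unfolding marks_def by (rule member_le_sum) auto

text \<open>\<open>recut\<close> pairs off the terms and preserves domain and target, so any weight
  \<open>F\<close> depending on these alone is allowed.\<close>

lemma even_sum_pairs_nonperiodic: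
  assumes "inj x"
  shows "even (\<Sum>P\<in>{P \<in> rect_pairs n x. tgt2 x P \<noteq> x}. F (dom2 x P) (tgt2 x P) :: int)"
  by (rule even_sum_involution[where \<tau> = "recut x"]) (use recut[OF assms] in auto)

section \<open>Annuli: pairs of rectangles that return to the starting generator\<close>

lemma arc_ind_succ: "a < n \<Longrightarrow> 1 < n \<Longrightarrow> c < n \<Longrightarrow> arc_ind a ((a + 1) mod n) c = of_bool (c = a)"
  by (cases "a + 1 = n") (auto simp: arc_ind_def)

lemma arc_ind_succ_unique:
  assumes "a < n" "b < n" "a \<noteq> b" "\<And>c. c < n \<Longrightarrow> c \<noteq> a \<Longrightarrow> c \<noteq> b \<Longrightarrow> arc_ind a b c = 0"
  shows "b = (a + 1) mod n"
proof (rule ccontr)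
  assume b: "b \<noteq> (a + 1) mod n"
  have "n > 1" using assms by auto
  then have "(a + 1) mod n < n" "(a + 1) mod n \<noteq> a" "arc_ind a b ((a + 1) mod n) = 1"
    using assms(1-3) b by (cases "a + 1 = n"; auto simp: arc_ind_def)+
  then show False using assms(4) b by fastforce
qed

lemma rect_tgt_involution: "rect_tgt (rect_tgt x a b) a b = x"
  by (auto simp: rect_tgt_def)

lemma rect_tgt_cancel:
  assumes "inj x" "rect_tgt (rect_tgt x a b) c d = x" "a \<noteq> b" "c \<noteq> d"
  shows "(c, d) = (a, b) \<or> (c, d) = (b, a)"
proof -
  have "\<And>i. rect_tgt (rect_tgt x a b) c d i = x i" using assms(2) by simp
  from this[of a] this[of b] this[of c] this[of d] show ?thesis
    using assms(3,4) inj_eq[OF assms(1)] by (auto simp: rect_tgt_def split: if_splits)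
qed

text \<open>The two rectangles have complementary row arcs and together fill the annulus between
  circles a and b. A point of \<open>x\<close> on a circle strictly between would lie in one of
  them, so the annulus has width one.\<close>

lemma vertical_annulus_iff:
  assumes "inj x"
  shows "((a, b), (a, b)) \<in> rect_pairs n x \<longleftrightarrow> a < n \<and> 1 < n \<and> b = (a + 1) mod n"
proof
  assume P: "((a, b), (a, b)) \<in> rect_pairs n x"
  then have ab: "a < n" "b < n" "a \<noteq> b" by (auto simp: rect_pairs_iff empty_rects_def)
  have "arc_ind a b c = 0" if "c < n" "c \<noteq> a" "c \<noteq> b" for c
  proof -
    have "mult x a b c (x c) + mult (rect_tgt x a b) a b c (x c) = arc_ind a b c"
      using arc_ind_complement[of "x a" "x b" "x c"] ab inj_eq[OF assms]
      by (simp add: mult_def rect_tgt_def flip: distrib_left)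
    moreover have "mult x a b c (x c) = 0" "mult (rect_tgt x a b) a b c (x c) = 0"
      using P that by (auto simp: rect_pairs_iff empty_rects_def rect_tgt_def)
    ultimately show ?thesis by simp
  qed
  then have "b = (a + 1) mod n" by (rule arc_ind_succ_unique[OF ab])
  then show "a < n \<and> 1 < n \<and> b = (a + 1) mod n" using ab by linarith
next
  assume R: "a < n \<and> 1 < n \<and> b = (a + 1) mod n"
  then have "a \<noteq> b" by (cases "a + 1 = n") auto
  then show "((a, b), (a, b)) \<in> rect_pairs n x"
    using R arc_ind_succ[of a n] by (auto simp: rect_pairs_iff empty_rects_def mult_def)
qed

lemma dom2_vertical:
  assumes "inj x" "a < n" "1 < n" "c < n"
  shows "dom2 x ((a, (a + 1) mod n), (a, (a + 1) mod n)) c j = of_bool (c = a)"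
proof -
  have "a \<noteq> (a + 1) mod n" using assms by (cases "a + 1 = n") auto
  then show ?thesis
    using arc_ind_succ[OF assms(2-4)] arc_ind_complement[of "x a" "x ((a + 1) mod n)" j] inj_eq[OF assms(1)]
    by (simp add: mult_def rect_tgt_def)
qed

lemma dom2_horizontal:
  assumes "a \<noteq> b"
  shows "dom2 x ((a, b), (b, a)) c j = arc_ind (x a) (x b) j"
  using arc_ind_complement[OF assms, of c] assms by (simp add: mult_def rect_tgt_def flip: distrib_right)

text \<open>Horizontal annuli have equal multiplicities on both sides of circle i, hence even
  crossing. Thin vertical annuli have crossing 1 only in columns i and i - 1; each contains exactly
  one mark, so these two contribute \<open>G 1\<close> each and cancel modulo 2.\<close>

lemma even_sum_pairs_periodic:
  assumes inj: "inj x" and i: "0 < i" "i < n"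
  shows "even (\<Sum>P\<in>{P \<in> rect_pairs n x. tgt2 x P = x}.
    crossing i h (dom2 x P) * G (marks n p (dom2 x P)) :: int)"
proof -
  define F where F: "F D = crossing i h D * G (marks n p D)" for D
  let ?V = "\<lambda>a. ((a, (a + 1) mod n), (a, (a + 1) mod n))"
  let ?T = "{P \<in> rect_pairs n x. tgt2 x P = x}"
  \<comment> \<open>The thin annuli on the two sides of circle i, the only ones with odd
    crossing.\<close>
  let ?W = "{?V i, ?V (i - 1)}"
  have n: "1 < n" using i by simp
  have W: "?W \<subseteq> ?T"
    using vertical_annulus_iff[OF inj] i n by (auto simp: rect_tgt_involution simp del: One_nat_def)
  have V: "F (dom2 x (?V a)) = of_bool (a = i \<or> a = i - 1) * G 1" if "a < n" for a
  proof -
    have "marks n p (dom2 x (?V a)) = (\<Sum>c<n. of_bool (c = a))"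
      unfolding marks_def using dom2_vertical[OF inj that n] by (intro sum.cong) auto
    also have "\<dots> = 1" using that by simp
    finally show ?thesis
      using dom2_vertical[OF inj that n] i by (auto simp: F crossing_def simp del: dom2.simps)
  qed
  have "even (F (dom2 x P))" if P: "P \<in> ?T - ?W" for P
  proof -
    obtain a b c d where Peq: "P = ((a, b), (c, d))" by (metis prod.exhaust)
    have neq: "a \<noteq> b" "c \<noteq> d" using P by (auto simp: Peq rect_pairs_iff empty_rects_def)
    consider "(c, d) = (a, b)" | "(c, d) = (b, a)"
      using rect_tgt_cancel[OF inj _ neq] P by (auto simp: Peq)
    then show ?thesis
    proof cases
      case 1
      then have "a < n" "b = (a + 1) mod n" using P vertical_annulus_iff[OF inj] by (auto simp: Peq)
      then have "F (dom2 x P) = of_bool (a = i \<or> a = i - 1) * G 1" "a \<noteq> i" "a \<noteq> i - 1"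
        using V[of a] P 1 by (auto simp: Peq simp del: dom2.simps)
      then show ?thesis by simp
    next
      case 2
      then show ?thesis
        using dom2_horizontal[OF neq(1)] by (simp add: F crossing_def Peq del: dom2.simps)
    qed
  qed
  then have "even (sum (\<lambda>P. F (dom2 x P)) (?T - ?W))" by (intro dvd_sum)
  moreover have "sum (\<lambda>P. F (dom2 x P)) ?W = F (dom2 x (?V i)) + F (dom2 x (?V (i - 1)))"
    using i by (subst sum.insert) auto
  moreover have "sum (\<lambda>P. F (dom2 x P)) ?T = sum (\<lambda>P. F (dom2 x P)) (?T - ?W) + sum (\<lambda>P. F (dom2 x P)) ?W"
    by (rule sum.subset_diff[OF W]) simp
  ultimately have "even (sum (\<lambda>P. F (dom2 x P)) ?T)" using V[of i] V[of "i - 1"] i by simp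
  then show ?thesis by (simp only: F)
qed

lemma even_sum_pairs:
  assumes inj: "inj x" and i: "0 < i" "i < n"
  shows "even (\<Sum>P\<in>rect_pairs n x. crossing i h (dom2 x P) * G (marks n p (dom2 x P)) (tgt2 x P) :: int)"
    (is "even (sum ?f _)")
proof -
  have "sum ?f (rect_pairs n x) = sum ?f {P \<in> rect_pairs n x. tgt2 x P = x} + sum ?f {P \<in> rect_pairs n x. tgt2 x P \<noteq> x}"
    by (subst sum.union_disjoint[symmetric]) (auto intro!: sum.cong)
  moreover have "even (sum ?f {P \<in> rect_pairs n x. tgt2 x P \<noteq> x})"
    using even_sum_pairs_nonperiodic[OF inj, of "\<lambda>D z. crossing i h D * G (marks n p D) z"] .
  moreover have "even (sum ?f {P \<in> rect_pairs n x. tgt2 x P = x})"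
    using even_sum_pairs_periodic[OF inj i, of h "\<lambda>m. G m x" p] by simp
  ultimately show ?thesis by simp
qed

section \<open>Commutation of adjacent columns\<close>

definition free_rects :: "nat \<Rightarrow> (nat \<Rightarrow> nat) \<Rightarrow> (nat \<Rightarrow> nat) \<Rightarrow> (nat \<times> nat) set" where
  "free_rects n p x = {(a, b) \<in> empty_rects n x. marks n p (mult x a b) = 0}"

text \<open>Only the parity of \<phi> matters: it is a cochain over the field with two elements that
  vanishes on boundaries in the complex with all variables set to 1.\<close>

definition cocycle :: "nat \<Rightarrow> (nat \<Rightarrow> nat) \<Rightarrow> ((nat \<Rightarrow> nat) \<Rightarrow> int) \<Rightarrow> bool" where
  "cocycle n p \<phi> \<longleftrightarrow> (\<forall>x. x permutes {..<n} \<longrightarrow>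
     even (\<Sum>(a, b)\<in>free_rects n p x. \<phi> (rect_tgt x a b)))"

definition detects :: "nat \<Rightarrow> (nat \<Rightarrow> nat) \<Rightarrow> (nat \<Rightarrow> nat) \<Rightarrow> bool" where
  "detects n p w \<longleftrightarrow> (\<exists>\<phi>. cocycle n p \<phi> \<and> odd (\<phi> w))"

text \<open>If p' is p with columns i - 1 and i exchanged, then counting
  X's of p' in a rectangle from x to y exceeds counting those of p by height x - height y.\<close>

definition height :: "nat \<Rightarrow> (nat \<Rightarrow> nat) \<Rightarrow> (nat \<Rightarrow> nat) \<Rightarrow> int" where
  "height i p z = of_bool (p i < z i \<and> z i \<le> p (i - 1))"

lemma height_ge_1_iff: "1 \<le> height i p z \<longleftrightarrow> p i < z i \<and> z i \<le> p (i - 1)"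
  by (simp add: height_def)

lemma sum_two_rects:
  assumes "finite A" "\<And>y. finite (B y)"
  shows "(\<Sum>(a, b)\<in>A. \<Sum>(c, d)\<in>B (rect_tgt x a b). f (rect_tgt (rect_tgt x a b) c d)) =
    (\<Sum>P\<in>Sigma A (\<lambda>(a, b). B (rect_tgt x a b)). f (tgt2 x P))"
proof -
  have "(\<Sum>(a, b)\<in>A. \<Sum>(c, d)\<in>B (rect_tgt x a b). f (rect_tgt (rect_tgt x a b) c d)) =
    (\<Sum>r\<in>A. \<Sum>s\<in>(case r of (a, b) \<Rightarrow> B (rect_tgt x a b)). f (tgt2 x (r, s)))"
    by (auto intro!: sum.cong)
  also have "\<dots> = (\<Sum>P\<in>Sigma A (\<lambda>(a, b). B (rect_tgt x a b)). f (tgt2 x P))"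
    by (subst sum.Sigma) (auto simp: assms intro: sum.cong)
  finally show ?thesis .
qed

text \<open>Exchanging the two columns removes the descent, so \<open>p'\<close> is the better
  sorted diagram and cocycles are pulled back from \<open>p'\<close> to \<open>p\<close>.\<close>

locale descent =
  fixes n i :: nat and p :: "nat \<Rightarrow> nat"
  assumes p: "p permutes {..<n}" and i: "0 < i" "i < n" and desc: "p i < p (i - 1)"
begin

definition p' :: "nat \<Rightarrow> nat" where "p' = p(i - 1 := p i, i := p (i - 1))"

lemma p_less: "c < n \<Longrightarrow> p c < n"
  using permutes_in_image[OF p, of c] by simp

text \<open>Only columns i - 1 and i contribute, and the difference factors. The column factor is
  nonzero only if a side lies on circle i; the row factor compares which of the rows x a, x b lie
  between the two X's.\<close>

lemma marks_commute:
  assumes "a \<noteq> b" "a < n" "b < n"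
  shows "marks n p' (mult x a b) = marks n p (mult x a b) + height i p x - height i p (rect_tgt x a b)"
proof -
  have [simp]: "i \<noteq> i - 1" "i - 1 \<noteq> i" using i by auto
  have split: "(\<Sum>c<n. f c) = (\<Sum>c\<in>{..<n} - {i - 1, i}. f c) + f (i - 1) + f i" for f :: "nat \<Rightarrow> int"
    using i sum.subset_diff[of "{i - 1, i}" "{..<n}" f] by auto
  have "marks n p' (mult x a b) - marks n p (mult x a b) =
     (arc_ind a b (i - 1) - arc_ind a b i) * (arc_ind (x a) (x b) (p i) - arc_ind (x a) (x b) (p (i - 1)))"
    unfolding marks_def split by (simp add: mult_def p'_def algebra_simps)
  also have "arc_ind a b (i - 1) - arc_ind a b i = of_bool (b = i) - of_bool (a = i)"
    using assms i by (auto simp: arc_ind_def)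
  also have "arc_ind (x a) (x b) (p i) - arc_ind (x a) (x b) (p (i - 1)) =
     of_bool (p i < x b \<and> x b \<le> p (i - 1)) - of_bool (p i < x a \<and> x a \<le> p (i - 1))"
    using desc by (auto simp: arc_ind_def)
  also have "(of_bool (b = i) - of_bool (a = i)) * \<dots> = height i p x - height i p (rect_tgt x a b)"
    using assms by (auto simp: height_def rect_tgt_def)
  finally show ?thesis by simp
qed

lemma odd_crossing_iff:
  assumes "a \<noteq> b"
  shows "odd (crossing i h (mult x a b)) \<longleftrightarrow> (a = i \<or> b = i) \<and> arc_ind (x a) (x b) h = 1"
  using assms i by (auto simp: crossing_def mult_def arc_ind_def)

text \<open>If the target has height 1, its point on circle i lies between the two X rows, and the
  side from there covers row \<open>h\<close>. A rectangle right of circle i (a = i) extends down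
  from that point and meets row \<open>p i\<close> first; one left of it (b = i) extends up and
  meets row \<open>p (i - 1)\<close> first. Either way it contains the X of the adjacent
  column.\<close>

lemma height_le_marks:
  assumes "a \<noteq> b" "h \<in> {p i, p (i - 1)}" "odd (crossing i h (mult x a b))"
  shows "height i p (rect_tgt x a b) \<le> marks n p (mult x a b)"
proof (cases "height i p (rect_tgt x a b) = 0")
  case True
  then show ?thesis using marks_nonneg by simp
next
  case False
  have "mult x a b i (p i) = 1 \<or> mult x a b (i - 1) (p (i - 1)) = 1"
    using False assms(1,2) assms(3)[unfolded odd_crossing_iff[OF assms(1)]] desc i
    by (auto simp: height_def rect_tgt_def mult_def arc_ind_def split: if_splits)
  moreover have "height i p (rect_tgt x a b) \<le> 1" by (simp add: height_def)
  ultimately show ?thesis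
    using marks_ge[of i n x a b p] marks_ge[of "i - 1" n x a b p] i by force
qed

text \<open>The rectangles of the commutation map, i.e. those which become pentagons in the usual
  picture with two curves between columns i - 1 and i.\<close>

definition comm_rects :: "nat \<Rightarrow> (nat \<Rightarrow> nat) \<Rightarrow> (nat \<times> nat) set" where
  "comm_rects h x = {(a, b) \<in> empty_rects n x. odd (crossing i h (mult x a b)) \<and>
     marks n p (mult x a b) = height i p (rect_tgt x a b)}"

lemma finite_comm_rects: "finite (comm_rects h x)" and finite_free_rects: "finite (free_rects n q x)"
  by (rule finite_subset[OF _ finite_empty_rects[of n x]]; auto simp: comm_rects_def free_rects_def)+

text \<open>The commutation map is a chain map modulo 2: composing it with the two differentials
  counts the same pairs, namely those with odd total crossing whose total number of marks is the
  least possible.\<close>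

lemma pullback_cocycle:
  assumes h: "h \<in> {p i, p (i - 1)}" and \<phi>: "cocycle n p' \<phi>"
  shows "cocycle n p (\<lambda>x. \<Sum>(a, b)\<in>comm_rects h x. \<phi> (rect_tgt x a b))"
  unfolding cocycle_def
proof (intro allI impI)
  fix x assume x: "x permutes {..<n}"
  let ?c = "\<lambda>x a b. crossing i h (mult x a b)"
  let ?f = "\<lambda>P. \<phi> (tgt2 x P)"
  let ?A = "Sigma (free_rects n p x) (\<lambda>(a, b). comm_rects h (rect_tgt x a b))"
  let ?B = "Sigma (comm_rects h x) (\<lambda>(a, b). free_rects n p' (rect_tgt x a b))"
  \<comment> \<open>The lowest order part, expressed through the total domain and the final target
    only, as \<open>even_sum_pairs\<close> requires.\<close>
  let ?good = "\<lambda>P. marks n p (dom2 x P) = height i p (tgt2 x P)"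
  let ?g = "\<lambda>P. crossing i h (dom2 x P) * (of_bool (?good P) * ?f P)"
  have fin: "finite ?A" "finite ?B"
    by (intro finite_SigmaI; auto simp: finite_comm_rects finite_free_rects)+
  have sub: "?A \<subseteq> rect_pairs n x" "?B \<subseteq> rect_pairs n x"
    by (auto simp: rect_pairs_iff comm_rects_def free_rects_def)
  have key: "even (?g P - (of_bool (P \<in> ?A) * ?f P + of_bool (P \<in> ?B) * ?f P))" if P: "P \<in> rect_pairs n x" for P
  proof -
    obtain a b c d where Peq: "P = ((a, b), (c, d))" by (metis prod.exhaust)
    let ?y = "rect_tgt x a b"
    have e: "(a, b) \<in> empty_rects n x" "(c, d) \<in> empty_rects n ?y" using P by (auto simp: Peq rect_pairs_iff)
    then have lt: "a \<noteq> b" "a < n" "b < n" "c \<noteq> d" "c < n" "d < n" by (auto simp: empty_rects_def)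
    have M: "marks n p (dom2 x P) = marks n p (mult x a b) + marks n p (mult ?y c d)"
      "crossing i h (dom2 x P) = ?c x a b + ?c ?y c d"
      unfolding Peq marks_dom2 crossing_dom2 by auto
    have m': "marks n p' (mult ?y c d) = marks n p (mult ?y c d) + height i p ?y - height i p (tgt2 x P)"
      using marks_commute lt by (simp add: Peq)
    \<comment> \<open>By \<open>height_le_marks\<close> an odd second rectangle uses at least
      \<open>height\<close> of the final target, so equality of the total leaves no mark for the
      first.\<close>
    have A: "P \<in> ?A \<longleftrightarrow> odd (?c ?y c d) \<and> ?good P"
      using height_le_marks[OF lt(4) h, of ?y] e marks_nonneg[of n p x a b]
      by (auto simp: Peq marks_dom2 comm_rects_def free_rects_def)
    \<comment> \<open>By \<open>m'\<close>, goodness says that the excess of marks over height in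
      the first rectangle plus the \<open>p'\<close>-marks of the second is 0. For an odd first
      rectangle both terms are nonnegative, so both vanish.\<close>
    have B: "P \<in> ?B \<longleftrightarrow> odd (?c x a b) \<and> ?good P"
      using height_le_marks[OF lt(1) h, of x] e marks_nonneg[of n p' ?y c d] m'
      by (auto simp: Peq marks_dom2 comm_rects_def free_rects_def)
    show ?thesis unfolding A B M by auto
  qed
  have "(\<Sum>(a, b)\<in>free_rects n p x. \<Sum>(c, d)\<in>comm_rects h (rect_tgt x a b). \<phi> (rect_tgt (rect_tgt x a b) c d))
      = sum ?f ?A"
    by (rule sum_two_rects) (simp_all add: finite_comm_rects finite_free_rects)
  moreover have "even (sum ?f ?B)"
  proof -
    have "sum ?f ?B = (\<Sum>(a, b)\<in>comm_rects h x. \<Sum>(c, d)\<in>free_rects n p' (rect_tgt x a b). \<phi> (rect_tgt (rect_tgt x a b) c d))"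
      by (rule sym, rule sum_two_rects) (simp_all add: finite_comm_rects finite_free_rects)
    moreover have "even (\<Sum>(c, d)\<in>free_rects n p' (rect_tgt x a b). \<phi> (rect_tgt (rect_tgt x a b) c d))"
      if "(a, b) \<in> comm_rects h x" for a b
      using \<phi> that rect_tgt_permutes[OF x, of a b] by (auto simp: cocycle_def comm_rects_def empty_rects_def)
    ultimately show ?thesis by (simp only:) (rule dvd_sum, auto)
  qed
  moreover have "even (sum ?f ?A + sum ?f ?B)"
  proof -
    have "sum ?f ?A = (\<Sum>P\<in>rect_pairs n x. of_bool (P \<in> ?A) * ?f P)" "sum ?f ?B = (\<Sum>P\<in>rect_pairs n x. of_bool (P \<in> ?B) * ?f P)"
      using sub by (auto intro!: sum.mono_neutral_cong_left)
    then have "sum ?f ?A + sum ?f ?B = sum ?g (rect_pairs n x) -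
        (\<Sum>P\<in>rect_pairs n x. ?g P - (of_bool (P \<in> ?A) * ?f P + of_bool (P \<in> ?B) * ?f P))"
      by (simp add: sum_subtractf sum.distrib)
    moreover have "even (sum ?g (rect_pairs n x))"
      by (rule even_sum_pairs[OF permutes_inj[OF x] i, of h "\<lambda>m z. of_bool (m = height i p z) * \<phi> z"])
    moreover have "even (\<Sum>P\<in>rect_pairs n x. ?g P - (of_bool (P \<in> ?A) * ?f P + of_bool (P \<in> ?B) * ?f P))"
      by (intro dvd_sum key)
    ultimately show ?thesis by presburger
  qed
  ultimately show "even (\<Sum>(a, b)\<in>free_rects n p x. \<Sum>(c, d)\<in>comm_rects h (rect_tgt x a b).
     \<phi> (rect_tgt (rect_tgt x a b) c d))" by simp
qed

lemma detects_commute: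
  assumes "h \<in> {p i, p (i - 1)}" "detects n p' w'" "comm_rects h w = {(a, b)}" "rect_tgt w a b = w'"
  shows "detects n p w"
  using assms pullback_cocycle[OF assms(1)] unfolding detects_def by fastforce

section \<open>The commutation map on the two distinguished generators\<close>

lemma comm_rects_x_minus: "comm_rects (p (i - 1)) p = {(i - 1, i)}"
proof -
  have "(a, b) = (i - 1, i)" if "(a, b) \<in> comm_rects (p (i - 1)) p" for a b
  proof -
    have ab: "(a, b) \<in> empty_rects n p" "a \<noteq> b" "a < n" and o: "a = i \<or> b = i" "arc_ind (p a) (p b) (p (i - 1)) = 1"
      and m: "marks n p (mult p a b) = height i p (rect_tgt p a b)"
      using that by (auto simp: comm_rects_def empty_rects_def odd_crossing_iff)
    \<comment> \<open>The lower left square of any rectangle starting at x^- carries an X, so the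
      height of the target must be 1.\<close>
    have "p a \<noteq> p b" using ab permutes_inj[OF p] by (simp add: inj_eq)
    then have "mult p a b a (p a) = 1" using ab by (simp add: mult_def)
    then have "1 \<le> height i p (rect_tgt p a b)"
      using marks_ge[of a n p a b p] ab m by simp
    then have g: "p i < rect_tgt p a b i" "rect_tgt p a b i \<le> p (i - 1)" by (auto simp: height_ge_1_iff)
    \<comment> \<open>If a = i, the row arc would run from \<open>p i\<close> to a row at most
      \<open>p (i - 1)\<close> and miss the row \<open>p (i - 1)\<close>; this is what the choice of
      \<open>h\<close> excludes.\<close>
    have "b = i" using o g ab desc by (auto simp: arc_ind_def rect_tgt_def)
    \<comment> \<open>A wider rectangle would contain the generator point on circle i - 1.\<close>
    moreover have "a = i - 1"
    proof (rule ccontr)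
      assume "a \<noteq> i - 1"
      then have "mult p a b (i - 1) (p (i - 1)) = 0"
        using ab i \<open>b = i\<close> by (auto simp: empty_rects_def)
      moreover have "arc_ind a i (i - 1) = 1" using ab i \<open>b = i\<close> by (auto simp: arc_ind_def)
      ultimately show False using o \<open>b = i\<close> by (simp add: mult_def)
    qed
    ultimately show ?thesis by simp
  qed
  moreover have "(i - 1, i) \<in> comm_rects (p (i - 1)) p"
  proof -
    have I: "arc_ind (i - 1) i c = of_bool (c = i - 1)" for c using i by (auto simp: arc_ind_def)
    have "marks n p (mult p (i - 1) i) = (\<Sum>c<n. of_bool (c = i - 1))"
      unfolding marks_def using I desc by (intro sum.cong) (auto simp: mult_def)
    then have "marks n p (mult p (i - 1) i) = 1" using i by simp
    then show ?thesis
      using i desc I by (auto simp: comm_rects_def empty_rects_def odd_crossing_iff height_def rect_tgt_def mult_def)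
  qed
  ultimately show ?thesis by auto
qed

lemma detects_x_minus: "detects n p' p' \<Longrightarrow> detects n p p"
  by (rule detects_commute[OF _ _ comm_rects_x_minus]) (auto simp: rect_tgt_def p'_def)

text \<open>The circle to the right of column i, which carries the upper right corner of its X; for
  i = n - 1 it is circle 0.\<close>

abbreviation "j \<equiv> (i + 1) mod n"

lemma x_plus_at: "x_plus n p i = (p (i - 1) + 1) mod n" "x_plus n p j = p i + 1"
proof -
  have *: "(i + n - 1) mod n = i - 1"
    using i by (metis Nat.add_diff_assoc2 One_nat_def Suc_leI add.commute less_imp_diff_less mod_add_self2 mod_less add_diff_assoc2)
  show "x_plus n p i = (p (i - 1) + 1) mod n" using i by (simp only: x_plus_def * if_True)
  have "(j + n - 1) mod n = i" using i by (cases "i + 1 = n") (auto simp: mod_if)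
  moreover have "p (i - 1) < n" using p_less i by simp
  then have "p i + 1 < n" using desc by linarith
  moreover have "j < n" using i by simp
  ultimately show "x_plus n p j = p i + 1" by (simp add: x_plus_def)
qed

text \<open>The mirror image of the argument for x^-: upper right corners replace lower left ones,
  and \<open>h\<close> is the row of the other X.\<close>

lemma comm_rects_x_plus:
  assumes inj: "inj (x_plus n p)"
  shows "comm_rects (p i) (x_plus n p) = {(i, j)}"
proof -
  let ?q = "x_plus n p"
  have n: "1 < n" and j: "j < n" "j \<noteq> i" using i by (auto simp: mod_if)
  have k: "p (i - 1) < n" using p_less i by simp
  have qi: "?q i = 0 \<and> p (i - 1) + 1 = n \<or> ?q i = p (i - 1) + 1 \<and> p (i - 1) + 1 < n"
    unfolding x_plus_at using k by (cases "p (i - 1) + 1 = n") auto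
  have "(a, b) = (i, j)" if "(a, b) \<in> comm_rects (p i) ?q" for a b
  proof -
    have ab: "(a, b) \<in> empty_rects n ?q" "a \<noteq> b" "a < n" "b < n" and o: "a = i \<or> b = i" "arc_ind (?q a) (?q b) (p i) = 1"
      and m: "marks n p (mult ?q a b) = height i p (rect_tgt ?q a b)"
      using that by (auto simp: comm_rects_def empty_rects_def odd_crossing_iff)
    have qne: "?q a \<noteq> ?q b" using ab inj by (simp add: inj_eq)
    \<comment> \<open>The column left of circle b. The upper right corner of the rectangle is the
      corner of the X in this column, so this X lies in the rectangle.\<close>
    let ?b = "(b + n - 1) mod n"
    have "arc_ind a b ?b = 1" "?b < n" using ab n by (cases "b = 0"; auto simp: arc_ind_def mod_if)+
    moreover have "arc_ind (?q a) (?q b) (p ?b) = 1"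
    proof -
      have "?q b = (p ?b + 1) mod n" using ab by (simp add: x_plus_def)
      moreover have "?q a < n" using ab by (simp add: x_plus_def)
      moreover have "p ?b < n" using p_less \<open>?b < n\<close> by blast
      ultimately show ?thesis using qne by (cases "p ?b + 1 = n") (auto simp: arc_ind_def)
    qed
    ultimately have "1 \<le> height i p (rect_tgt ?q a b)"
      using marks_ge[of ?b n ?q a b p] m by (simp add: mult_def)
    then have g: "p i < rect_tgt ?q a b i" "rect_tgt ?q a b i \<le> p (i - 1)" by (auto simp: height_ge_1_iff)
    \<comment> \<open>If b = i, the row arc would start above \<open>p i\<close> and end just past
      \<open>p (i - 1)\<close>, missing row \<open>p i\<close>. For \<open>p (i - 1) = n - 1\<close>
      its end is circle 0.\<close>
    have "a = i" using o g ab desc qi by (auto simp: arc_ind_def rect_tgt_def split: if_splits)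
    \<comment> \<open>Otherwise the point (j, p i + 1) of x^+ would lie inside the
      rectangle.\<close>
    moreover have "b = j"
    proof (rule ccontr)
      assume b: "b \<noteq> j"
      then have "mult ?q a b j (?q j) = 0" using ab \<open>a = i\<close> j by (auto simp: empty_rects_def)
      moreover have "arc_ind i b j = 1" using ab \<open>a = i\<close> b j i by (cases "i + 1 = n") (auto simp: arc_ind_def)
      moreover have "?q b \<noteq> ?q j" using inj b by (simp add: inj_eq)
      then have "arc_ind (?q i) (?q b) (?q j) = 1"
        using g \<open>a = i\<close> ab qi desc unfolding x_plus_at(2) by (auto simp: arc_ind_def rect_tgt_def)
      ultimately show False using \<open>a = i\<close> by (simp add: mult_def)
    qed
    ultimately show ?thesis by simp
  qed
  moreover have "(i, j) \<in> comm_rects (p i) ?q"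
  proof -
    have I: "arc_ind i j c = of_bool (c = i)" if "c < n" for c using arc_ind_succ[OF i(2) n that] .
    have H: "arc_ind (?q i) (?q j) (p i) = 1" using qi desc unfolding x_plus_at(2) by (auto simp: arc_ind_def)
    have "marks n p (mult ?q i j) = (\<Sum>c<n. of_bool (c = i))"
      unfolding marks_def using I H by (intro sum.cong) (auto simp: mult_def)
    then have "marks n p (mult ?q i j) = 1" using i by simp
    then show ?thesis
      using i desc I H j x_plus_at(2) by (auto simp: comm_rects_def empty_rects_def odd_crossing_iff height_def rect_tgt_def mult_def)
  qed
  ultimately show ?thesis by (metis (no_types, opaque_lifting) singleton_iff surj_pair set_eqI)
qed

text \<open>The upper right corners of the X's in columns i - 1 and i lie on circles i and j, so
  exchanging these X's is the transposition of i and j on x^+.\<close>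

lemma detects_x_plus:
  assumes "detects n p' (x_plus n p')" "inj (x_plus n p)"
  shows "detects n p (x_plus n p)"
proof (rule detects_commute[OF _ assms(1) comm_rects_x_plus[OF assms(2)]])
  have pred: "(c + n - 1) mod n = i - 1 \<longleftrightarrow> c = i" "(c + n - 1) mod n = i \<longleftrightarrow> c = j" if "c < n" for c
    using that i by (cases "c = 0"; cases "i + 1 = n"; auto simp: mod_if)+
  have "p (i - 1) < n" using p_less i by simp
  then have pi: "(p i + 1) mod n = p i + 1" using desc by simp
  have j: "j \<noteq> i" "j < n" using i by (auto simp: mod_if)
  have "rect_tgt (x_plus n p) i j c = x_plus n p' c" for c
  proof -
    consider "c = i" | "c = j" | "c \<noteq> i" "c \<noteq> j" "c < n" | "\<not> c < n" by blast
    then show ?thesis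
    proof cases
      case 1
      have "(i + n - 1) mod n = i - 1" using pred(1)[OF i(2)] by blast
      then have "x_plus n p' i = (p' (i - 1) + 1) mod n" using i by (simp only: x_plus_def if_True)
      then show ?thesis using 1 i j pi by (simp add: rect_tgt_def x_plus_at p'_def del: One_nat_def)
    next
      case 2
      have "(j + n - 1) mod n = i" using pred(2)[OF j(2)] by blast
      then have "x_plus n p' j = (p' i + 1) mod n" using j by (simp only: x_plus_def if_True)
      then show ?thesis using 2 by (simp add: rect_tgt_def x_plus_at p'_def)
    next
      case 3
      then have "p' ((c + n - 1) mod n) = p ((c + n - 1) mod n)"
        using pred[of c] by (simp only: p'_def fun_upd_apply if_False)
      then show ?thesis using 3 by (simp only: rect_tgt_def x_plus_def fun_upd_apply if_True if_False)
    next
      case 4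
      then show ?thesis using i j by (auto simp: rect_tgt_def x_plus_def)
    qed
  qed
  then show "rect_tgt (x_plus n p) i j = x_plus n p'" by blast
qed simp

end

section \<open>Cocycles for arbitrary diagrams\<close>

lemma x_plus_permutes:
  assumes "p permutes {..<n}"
  shows "x_plus n p permutes {..<n}"
proof (rule bij_imp_permutes)
  have "inj_on (x_plus n p) {..<n}"
  proof (rule inj_onI)
    fix c d assume cd: "c \<in> {..<n}" "d \<in> {..<n}" and eq: "x_plus n p c = x_plus n p d"
    define e f where "e = (c + n - 1) mod n" and "f = (d + n - 1) mod n"
    have ef: "e < n" "f < n" using cd by (auto simp: e_def f_def)
    then have "p e < n" "p f < n" using permutes_in_image[OF assms] by (metis lessThan_iff)+
    moreover have "(p e + 1) mod n = (p f + 1) mod n"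
      using eq cd by (simp add: x_plus_def e_def f_def)
    ultimately have "p e = p f"
      by (cases "p e + 1 = n"; cases "p f + 1 = n") auto
    then have "e = f" using permutes_inj[OF assms] by (simp add: inj_eq)
    then show "c = d" using cd by (cases "c = 0"; cases "d = 0") (auto simp: e_def f_def mod_if split: if_splits)
  qed
  moreover have "x_plus n p ` {..<n} \<subseteq> {..<n}" by (auto simp: x_plus_def)
  ultimately show "bij_betw (x_plus n p) {..<n} {..<n}"
    by (simp add: bij_betw_def endo_inj_surj)
qed (simp add: x_plus_def)

lemma x_plus_id: "x_plus n id = id"
proof
  show "x_plus n id c = id c" for c
  proof (cases "c < n")
    case True
    then have "((c + n - 1) mod n + 1) mod n = (c + n) mod n"
      using mod_add_left_eq[of "c + n - 1" n 1] True by simp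
    then show ?thesis using True by (simp add: x_plus_def)
  qed (simp add: x_plus_def)
qed

lemma cocycle_id: "cocycle n id (\<lambda>x. of_bool (x = id))"
  unfolding cocycle_def
proof (intro allI impI)
  fix x assume "x permutes {..<n}"
  let ?T = "{(a, b) \<in> free_rects n id x. rect_tgt x a b = id}"
  have fin: "finite (free_rects n id x)"
    by (rule finite_subset[OF _ finite_empty_rects[of n x]]) (auto simp: free_rects_def)
  have "even (\<Sum>r\<in>?T. 1 :: int)"
  proof (rule even_sum_involution[where \<tau> = prod.swap])
    show "finite ?T" by (rule finite_subset[OF _ fin]) auto
    fix r assume "r \<in> ?T"
    then obtain a b where r: "r = (a, b)" "(a, b) \<in> free_rects n id x" "rect_tgt x a b = id" by auto
    then have ab: "a \<noteq> b" "a < n" "b < n" by (auto simp: free_rects_def empty_rects_def)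
    have "x = rect_tgt id a b" using r rect_tgt_involution by metis
    then have x: "x a = b" "x b = a" "\<And>i. i \<noteq> a \<Longrightarrow> i \<noteq> b \<Longrightarrow> x i = i"
      using ab by (auto simp: rect_tgt_def)
    \<comment> \<open>The row arc of the rectangle is complementary to its column arc, so no
      diagonal square lies in it; all X's and all points of \<open>x\<close> off the two columns are
      on the diagonal.\<close>
    have "arc_ind b a i * arc_ind a b i = 0" for i
      by (auto simp: arc_ind_def)
    then have "mult x b a i i = 0" for i by (simp add: mult_def x)
    then have "(b, a) \<in> free_rects n id x" using ab x by (auto simp: free_rects_def empty_rects_def marks_def)
    moreover have "rect_tgt x b a = id" using r(3) ab by (simp add: rect_tgt_def fun_upd_twist)
    ultimately show "prod.swap r \<in> ?T \<and> prod.swap (prod.swap r) = r \<and> prod.swap r \<noteq> r \<and> 1 = (1 :: int)"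
      using r ab by auto
  qed
  also have "(\<Sum>r\<in>?T. 1 :: int) = (\<Sum>(a, b)\<in>free_rects n id x. of_bool (rect_tgt x a b = id))"
    using fin by (intro sum.mono_neutral_cong_left) (auto split: if_splits)
  finally show "even (\<Sum>(a, b)\<in>free_rects n id x. of_bool (rect_tgt x a b = id) :: int)" .
qed

section \<open>Sorting the columns towards the diagonal diagram\<close>

lemma permutes_no_descent:
  fixes p :: "nat \<Rightarrow> nat"
  assumes p: "p permutes {..<n}" and asc: "\<And>i. 0 < i \<Longrightarrow> i < n \<Longrightarrow> p (i - 1) \<le> p i"
  shows "p = id"
proof -
  have less: "p c < n" if "c < n" for c using permutes_in_image[OF p, of c] that by simp
  have mono: "p c < p (Suc c)" if "Suc c < n" for c
  proof -
    have "p c \<noteq> p (Suc c)" using permutes_inj[OF p] by (simp add: inj_eq)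
    then show ?thesis using asc[of "Suc c"] that by simp
  qed
  have lower: "c \<le> p c" if "c < n" for c
    using that by (induction c) (use mono in \<open>fastforce+\<close>)
  have upper: "p (n - Suc c) \<le> n - Suc c" if "c < n" for c
    using that
  proof (induction c)
    case 0
    then show ?case using less[of "n - 1"] by simp
  next
    case (Suc c)
    have "Suc (n - Suc (Suc c)) = n - Suc c" using Suc.prems by simp
    then show ?case using mono[of "n - Suc (Suc c)"] Suc by simp
  qed
  have "p c = c" for c
  proof (cases "c < n")
    case True
    then show ?thesis using lower[of c] upper[of "n - Suc c"] by simp
  next
    case False
    then show ?thesis using p by (simp add: permutes_def)
  qed
  then show ?thesis by auto
qed

text \<open>Bubble sort: as long as there is a descent, exchange its columns and pull the cocycles
  back. The sum of c * p c increases with each exchange and is at most \<open>n * n * n\<close>,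
  which gives the measure.\<close>

lemma detects_x_minus_x_plus:
  assumes "p permutes {..<n}"
  shows "detects n p p \<and> detects n p (x_plus n p)"
  using assms
proof (induction "n * n * n - (\<Sum>c<n. c * p c)" arbitrary: p rule: less_induct)
  case less
  show ?case
  proof (cases "\<exists>i. 0 < i \<and> i < n \<and> p i < p (i - 1)")
    case False
    then have "p = id" using permutes_no_descent[OF less.prems] by (meson not_le)
    then show ?thesis using cocycle_id[of n] by (auto simp: detects_def x_plus_id)
  next
    case True
    then obtain i where i: "0 < i" "i < n" "p i < p (i - 1)" by blast
    interpret descent n i p using less.prems i by unfold_locales
    have p'_perm: "p' permutes {..<n}"
      using rect_tgt_permutes[OF less.prems, of "i - 1" i] i by (simp add: p'_def rect_tgt_def)
    have bound: "(\<Sum>c<n. c * q c) \<le> n * n * n" if "q permutes {..<n}" for q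
    proof -
      have "q c \<le> n" if "c < n" for c
        using permutes_in_image[OF \<open>q permutes {..<n}\<close>, of c] that by simp
      then have "(\<Sum>c<n. c * q c) \<le> (\<Sum>c<n. n * n)"
        by (intro sum_mono mult_mono) auto
      then show ?thesis by simp
    qed
    have split: "(\<Sum>c<n. f c) = (\<Sum>c\<in>{..<n} - {i - 1, i}. f c) + f (i - 1) + f i" for f :: "nat \<Rightarrow> nat"
      using i sum.subset_diff[of "{i - 1, i}" "{..<n}" f] by auto
    \<comment> \<open>The gain is exactly \<open>p (i - 1) - p i\<close>, positive by the
      descent.\<close>
    have "(i - 1) * p (i - 1) + i * p i < (i - 1) * p i + i * p (i - 1)"
    proof -
      obtain k where "i = Suc k" using i(1) gr0_conv_Suc by blast
      then show ?thesis using desc by simp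
    qed
    moreover have "p' (i - 1) = p i" "p' i = p (i - 1)" using i(1) by (auto simp: p'_def)
    moreover have "(\<Sum>c\<in>{..<n} - {i - 1, i}. c * p' c) = (\<Sum>c\<in>{..<n} - {i - 1, i}. c * p c)"
      by (intro sum.cong) (auto simp: p'_def)
    ultimately have "(\<Sum>c<n. c * p c) < (\<Sum>c<n. c * p' c)"
      unfolding split by (simp only: add.assoc add_less_cancel_left)
    then have "n * n * n - (\<Sum>c<n. c * p' c) < n * n * n - (\<Sum>c<n. c * p c)"
      using bound[OF p'_perm] by (meson diff_less_mono2 order.strict_trans2)
    then have IH: "detects n p' p'" "detects n p' (x_plus n p')" using less.hyps[OF _ p'_perm] by blast+
    have "detects n p (x_plus n p)"
      using detects_x_plus IH permutes_inj[OF x_plus_permutes[OF less.prems]] by blast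
    then show ?thesis using detects_x_minus IH by blast
  qed
qed

section \<open>Rectangles of the grid complex as products of arc indicators\<close>

lemma in_arc_iff_arc_ind:
  assumes "s < n" "e < n" "t < n"
  shows "in_arc n s ((e + n - s) mod n) t \<longleftrightarrow> arc_ind s e t = 1"
proof -
  have "(e + n - s) mod n = (if s \<le> e then e - s else e + n - s)" if "e < n" for e
    using assms that by (auto simp: mod_if)
  then show ?thesis using assms by (auto simp: in_arc_def arc_ind_def)
qed

lemma in_arc_open_iff:
  assumes "s < n" "t < n"
  shows "in_arc_open n s w t \<longleftrightarrow> t \<noteq> s \<and> in_arc n s w t"
proof -
  have "(t + n - s) mod n = 0 \<longleftrightarrow> t = s"
    using assms by (cases "s \<le> t") (auto simp: mod_if)
  then show ?thesis by (auto simp: in_arc_open_def in_arc_def)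
qed

context
  fixes n :: nat and x :: "nat \<Rightarrow> nat" and a b :: nat
  assumes x: "x permutes {..<n}" and ab: "a < n" "b < n" "a \<noteq> b"
begin

lemma x_less: "c < n \<Longrightarrow> x c < n"
  using permutes_in_image[OF x, of c] by simp

lemma in_rect_iff_mult:
  assumes "i < n" "j < n"
  shows "in_rect n x a b (i, j) \<longleftrightarrow> mult x a b i j \<noteq> 0"
proof -
  have "in_rect n x a b (i, j) \<longleftrightarrow> arc_ind a b i = 1 \<and> arc_ind (x a) (x b) j = 1"
    using assms ab x_less by (simp add: in_rect_def rect_width_def rect_height_def in_arc_iff_arc_ind)
  moreover have "arc_ind s e t = 0 \<or> arc_ind s e t = 1" for s e t by (simp add: arc_ind_def)
  ultimately show ?thesis unfolding mult_def by (metis mult_eq_0_iff zero_neq_one)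
qed

lemma rect_empty_iff_empty_rects: "rect_empty n x a b \<longleftrightarrow> (a, b) \<in> empty_rects n x"
proof -
  have "in_arc_open n a (rect_width n a b) i \<and> in_arc_open n (x a) (rect_height n x a b) (x i) \<longleftrightarrow>
    i \<noteq> a \<and> i \<noteq> b \<and> mult x a b i (x i) \<noteq> 0" if i: "i < n" for i
  proof -
    have "in_arc_open n a (rect_width n a b) i \<and> in_arc_open n (x a) (rect_height n x a b) (x i) \<longleftrightarrow>
      i \<noteq> a \<and> in_rect n x a b (i, x i)"
      using i ab x_less in_arc_open_iff permutes_inj[OF x] by (auto simp: in_rect_def inj_eq)
    moreover have "mult x a b b (x b) = 0" using ab by (auto simp: mult_def arc_ind_def)
    ultimately show ?thesis using in_rect_iff_mult[OF i x_less[OF i]] by auto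
  qed
  then show ?thesis using ab by (auto simp: rect_empty_def empty_rects_def)
qed

lemma rect_X_free_iff_marks:
  assumes "p permutes {..<n}"
  shows "rect_X_free n p x a b \<longleftrightarrow> marks n p (mult x a b) = 0"
proof -
  have "p c < n" if "c < n" for c using permutes_in_image[OF assms, of c] that by simp
  then show ?thesis
    by (auto simp: rect_X_free_def marks_def sum_nonneg_eq_0_iff in_rect_iff_mult)
qed

end

section \<open>The grid complex\<close>

text \<open>Setting all variables to 1: multiplication by the monomial with exponent
  \<open>e\<close> only shifts exponents and keeps the sum of the coefficients. \<open>T\<close> has
  to contain the shifted support.\<close>

lemma sum_shift_monomial:
  fixes c :: "(nat \<Rightarrow> nat) \<Rightarrow> int"
  assumes "finite T" "\<And>m. m \<in> M \<Longrightarrow> (\<lambda>j. m j + e j) \<in> T" "\<And>m. c m \<noteq> 0 \<Longrightarrow> m \<in> M"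
  shows "(\<Sum>m\<in>T. if \<forall>j. e j \<le> m j then c (\<lambda>j. m j - e j) else 0) = (\<Sum>m\<in>M. c m)"
proof -
  let ?s = "\<lambda>m j. m j + e j"
  have "(\<Sum>m\<in>T. if \<forall>j. e j \<le> m j then c (\<lambda>j. m j - e j) else 0) =
    (\<Sum>m\<in>?s ` M. c (\<lambda>j. m j - e j))"
  proof (rule sum.mono_neutral_cong_right)
    show "\<forall>m\<in>T - ?s ` M. (if \<forall>j. e j \<le> m j then c (\<lambda>j. m j - e j) else 0) = 0"
    proof
      fix m assume m: "m \<in> T - ?s ` M"
      have "(\<lambda>j. m j - e j) \<notin> M" if "\<forall>j. e j \<le> m j"
      proof
        assume "(\<lambda>j. m j - e j) \<in> M"
        then have "?s (\<lambda>j. m j - e j) \<in> ?s ` M" by (rule imageI)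
        then show False using m that by simp
      qed
      then show "(if \<forall>j. e j \<le> m j then c (\<lambda>j. m j - e j) else 0) = 0"
        using assms(3) by auto
    qed
  qed (use assms in auto)
  also have "\<dots> = (\<Sum>m\<in>M. c m)"
    by (subst sum.reindex) (auto simp: inj_on_def fun_eq_iff)
  finally show ?thesis .
qed

text \<open>Summing coefficients over all monomials and applying \<phi> sends every boundary to an
  even number, but a power of a variable times \<open>w\<close> to the odd number \<phi> w.\<close>

lemma not_boundary_if_detects:
  assumes p: "p permutes {..<n}" and w: "w permutes {..<n}" and det: "detects n p w"
    and S: "sign_assignment n S"
  shows "\<not> CK_minus_boundary n p os S (U_pow_gen i d w)"
proof
  assume "CK_minus_boundary n p os S (U_pow_gen i d w)"
  then obtain c where c: "grid_chain n c" and bd: "CK_minus_diff n p os S c = U_pow_gen i d w"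
    by (auto simp: CK_minus_boundary_def)
  obtain \<phi> where \<phi>: "cocycle n p \<phi>" and odd: "odd (\<phi> w)"
    using det by (auto simp: detects_def)
  let ?G = "{x. x permutes {..<n}}"
  let ?K = "Sigma ?G (free_rects n p)"
  define ex where "ex = (\<lambda>(x, (a, b)). rect_O n os x a b)"
  define tg where "tg = (\<lambda>(x, (a, b)). rect_tgt x a b :: nat \<Rightarrow> nat)"
  define sg where "sg = (\<lambda>(x, (a, b)). S x a b)"
  define M where "M = snd ` {q. c q \<noteq> 0}"
  define m0 where "m0 = (\<lambda>j. if j = i then d else 0 :: nat)"
  \<comment> \<open>A finite set of monomials containing the one on the right and every one that a
    free rectangle can produce from the support of \<open>c\<close>.\<close>
  define T where "T = insert m0 (\<Union>k\<in>?K. (\<lambda>m j. m j + ex k j) ` M)"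
  define h where "h k m = (if \<forall>j. ex k j \<le> m j then c (fst k, \<lambda>j. m j - ex k j) else 0)" for k m
  have finF: "finite (free_rects n p x)" for x
    by (rule finite_subset[OF _ finite_empty_rects[of n x]]) (auto simp: free_rects_def)
  have finG: "finite ?G" by (rule finite_permutations) simp
  have finK: "finite ?K" using finG finF by (intro finite_SigmaI) auto
  have "finite M" using c by (simp add: M_def grid_chain_def)
  then have finT: "finite T" using finK by (auto simp: T_def)
  have tgG: "tg k \<in> ?G" if "k \<in> ?K" for k
    using that rect_tgt_permutes by (auto simp: tg_def free_rects_def empty_rects_def)
  have diff: "CK_minus_diff n p os S c (y, m) = (\<Sum>k\<in>?K. if tg k = y then sg k * h k m else 0)" for y m
  proof -
    have "(\<Sum>(a, b)\<in>{(a, b). rect_valid n x a b \<and> rect_tgt x a b = y \<and> rect_empty n x a b \<and>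
                rect_X_free n p x a b \<and> (\<forall>j. rect_O n os x a b j \<le> m j)}.
              S x a b * c (x, \<lambda>j. m j - rect_O n os x a b j)) =
          (\<Sum>r\<in>free_rects n p x. if tg (x, r) = y then sg (x, r) * h (x, r) m else 0)"
      if x: "x \<in> ?G" for x
    proof -
      have "{(a, b). rect_valid n x a b \<and> rect_tgt x a b = y \<and> rect_empty n x a b \<and>
                rect_X_free n p x a b \<and> (\<forall>j. rect_O n os x a b j \<le> m j)} =
            {(a, b) \<in> free_rects n p x. rect_tgt x a b = y \<and> (\<forall>j. rect_O n os x a b j \<le> m j)}"
      proof -
        have "rect_valid n x a b \<and> rect_empty n x a b \<and> rect_X_free n p x a b \<longleftrightarrow> (a, b) \<in> free_rects n p x" for a b
          using x rect_empty_iff_empty_rects[of x n a b] rect_X_free_iff_marks[of x n a b p] p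
          by (auto simp: rect_valid_def grid_gen_def free_rects_def) (auto simp: empty_rects_def)
        then show ?thesis by blast
      qed
      then show ?thesis
        by (simp only:) (rule sum.mono_neutral_cong_left; auto simp: finF tg_def sg_def h_def ex_def)
    qed
    then show ?thesis
      unfolding CK_minus_diff_def grid_gen_def using finG finF
      by (simp add: sum.Sigma)
  qed
  \<comment> \<open>Evaluation of \<phi> on the assumed boundary; below, the same sum is computed
    from \<open>c\<close> and regrouped by rectangles.\<close>
  have "\<phi> w = (\<Sum>y\<in>?G. \<Sum>m\<in>T. \<phi> y * U_pow_gen i d w (y, m))"
  proof -
    have "(\<Sum>m\<in>T. \<phi> y * U_pow_gen i d w (y, m)) = (if y = w then \<phi> w else 0)" for y
      using finT by (auto simp: U_pow_gen_def T_def m0_def[symmetric] if_distrib sum.delta cong: if_cong)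
    then show ?thesis using w finG by simp
  qed
  also have "\<dots> = (\<Sum>y\<in>?G. \<Sum>m\<in>T. \<Sum>k\<in>?K. \<phi> y * (if tg k = y then sg k * h k m else 0))"
    unfolding bd[symmetric] diff sum_distrib_left ..
  also have "\<dots> = (\<Sum>y\<in>?G. \<Sum>k\<in>?K. \<Sum>m\<in>T. \<phi> y * (if tg k = y then sg k * h k m else 0))"
    by (intro sum.cong refl sum.swap)
  also have "\<dots> = (\<Sum>k\<in>?K. \<Sum>y\<in>?G. \<Sum>m\<in>T. \<phi> y * (if tg k = y then sg k * h k m else 0))"
    by (rule sum.swap)
  also have "\<dots> = (\<Sum>k\<in>?K. \<phi> (tg k) * sg k * (\<Sum>m\<in>M. c (fst k, m)))"
  proof (rule sum.cong[OF refl])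
    fix k assume k: "k \<in> ?K"
    have "(\<Sum>y\<in>?G. \<Sum>m\<in>T. \<phi> y * (if tg k = y then sg k * h k m else 0)) =
      (\<Sum>y\<in>?G. if tg k = y then \<phi> y * sg k * (\<Sum>m\<in>T. h k m) else 0)"
      by (intro sum.cong) (auto simp: sum_distrib_left mult.assoc)
    also have "\<dots> = \<phi> (tg k) * sg k * (\<Sum>m\<in>T. h k m)"
      using finG tgG[OF k] by (simp add: sum.delta)
    also have "(\<Sum>m\<in>T. h k m) = (\<Sum>m\<in>M. c (fst k, m))"
      unfolding h_def
    proof (rule sum_shift_monomial[OF finT])
      show "(\<lambda>j. m j + ex k j) \<in> T" if "m \<in> M" for m
        using k that unfolding T_def by blast
      show "m \<in> M" if "c (fst k, m) \<noteq> 0" for m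
        using that unfolding M_def by force
    qed
    finally show "(\<Sum>y\<in>?G. \<Sum>m\<in>T. \<phi> y * (if tg k = y then sg k * h k m else 0)) =
      \<phi> (tg k) * sg k * (\<Sum>m\<in>M. c (fst k, m))" .
  qed
  also have "\<dots> = (\<Sum>x\<in>?G. (\<Sum>r\<in>free_rects n p x. \<phi> (tg (x, r)) * sg (x, r)) * (\<Sum>m\<in>M. c (x, m)))"
    using finG finF by (simp add: sum_distrib_right sum.Sigma split_def)
  finally have "\<phi> w = \<dots>" .
  moreover have "even (\<Sum>r\<in>free_rects n p x. \<phi> (tg (x, r)) * sg (x, r))" if x: "x \<in> ?G" for x
  proof -
    \<comment> \<open>Signs are 1 or -1, so they disappear modulo 2 and the cocycle condition
      applies.\<close>
    have "even (\<phi> (tg (x, r)) * sg (x, r) - \<phi> (tg (x, r)))" if "r \<in> free_rects n p x" for r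
    proof -
      obtain a b where r: "r = (a, b)" by fastforce
      have "rect_valid n x a b"
        using x that by (auto simp: r rect_valid_def grid_gen_def free_rects_def empty_rects_def)
      then have "sg (x, r) = 1 \<or> sg (x, r) = -1"
        using S unfolding sign_assignment_def by (auto simp: r sg_def)
      then show ?thesis by auto
    qed
    then have "even (\<Sum>r\<in>free_rects n p x. \<phi> (tg (x, r)) * sg (x, r) - \<phi> (tg (x, r)))"
      by (rule dvd_sum)
    moreover have "even (\<Sum>r\<in>free_rects n p x. \<phi> (tg (x, r)))"
      using \<phi> x by (simp add: cocycle_def tg_def split_def)
    ultimately show ?thesis by (simp add: sum_subtractf)
  qed
  ultimately have "even (\<phi> w)" by (simp only:) (rule dvd_sum, rule dvd_mult2, blast)
  then show False using odd by simp
qed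

text \<open>U^d times a class is represented by the d-th power of any one variable times its cycle,
  so being non-torsion means that none of these chains is a boundary. The transverse invariant is
  the class of x^+ for a grid diagram of a Legendrian approximation.\<close>

theorem theorem1p5:
  fixes n :: nat and xs os :: "nat \<Rightarrow> nat"
    and S :: "(nat \<Rightarrow> nat) \<Rightarrow> nat \<Rightarrow> nat \<Rightarrow> int"
  assumes "knot_grid n xs os"
    and "sign_assignment n S"
  shows "\<forall>i<n. \<forall>d::nat.
           \<not> CK_minus_boundary n xs os S (U_pow_gen i d (x_plus n xs)) \<and>
           \<not> CK_minus_boundary n xs os S (U_pow_gen i d (x_minus n xs))"
proof -
  have xs: "xs permutes {..<n}"
    using assms(1) by (simp add: knot_grid_def grid_diagram_def)
  show ?thesis
    using detects_x_minus_x_plus[OF xs] x_plus_permutes[OF xs] xs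
      not_boundary_if_detects[OF xs _ _ assms(2)]
    by (simp add: x_minus_def)
qed

end
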